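(* For $n\geqslant 2$, the action of $\mathrm{SL}(n,\mathbb{Z})$ on $X_n=\mathrm{SL}(n,\mathbb{R})/\mathrm{SO}(n,\mathbb{R})$ is not well displacing, although, for $n\geqslant 3$, its orbit maps are quasi-isometric embeddings.
   Context: $X_n$ is the Riemannian symmetric space of $\mathrm{SL}(n,\mathbb{R})$, with its invariant symmetric metric, on which $\mathrm{SL}(n,\mathbb{Z})$ acts by left multiplication. Let $\Gamma$ be a finitely generated group with finite generating set $S$, word length $\Vert\cdot\Vert$ and word metric $d_S$. The translation length is $\ell(\gamma)=\inf_{\eta\in\Gamma}\Vert\eta\gamma\eta^{-1}\Vert$. For an isometry $\gamma$ of a metric space $X$, the displacement is $d_X(\gamma)=\inf_{x\in X}d(x,\gamma(x))$. An action of $\Gamma$ by isometries on $X$ is well displacing if there exist positive constants $A,B$ such that $d_X(\gamma)\geqslant A\,\ell(\gamma)-B$ for all $\gamma\in\Gamma$. Orbit maps are the maps $\Gamma\to X$, $\gamma\mapsto\gamma(x)$; such a map is a quasi-isometric embedding if there are $A\geqslant 1$, $B\geqslant 0$ with $A^{-1}d_S(\gamma,\eta)-B\leqslant d(\gamma(x),\eta(x))\leqslant A\,d_S(\gamma,\eta)+B$ for all $\gamma,\eta\in\Gamma$. *)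

theory Defs
  imports "HOL-Analysis.Analysis" "HOL-Algebra.Generated_Groups" "HOL-Algebra.Left_Coset"
begin

definition word_length :: "('g, 'm) monoid_scheme \<Rightarrow> 'g set \<Rightarrow> 'g \<Rightarrow> nat" where
  "word_length G S \<gamma> =
     (LEAST k. \<exists>ws. length ws = k \<and> set ws \<subseteq> S \<union> m_inv G ` S \<and>
                    foldr (mult G) ws \<one>\<^bsub>G\<^esub> = \<gamma>)"

definition word_dist :: "('g, 'm) monoid_scheme \<Rightarrow> 'g set \<Rightarrow> 'g \<Rightarrow> 'g \<Rightarrow> real" where
  "word_dist G S \<gamma> \<eta> = real (word_length G S (inv\<^bsub>G\<^esub> \<gamma> \<otimes>\<^bsub>G\<^esub> \<eta>))"

definition translation_length :: "('g, 'm) monoid_scheme \<Rightarrow> 'g set \<Rightarrow> 'g \<Rightarrow> nat" where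
  "translation_length G S \<gamma> =
     (INF \<eta>\<in>carrier G. word_length G S (\<eta> \<otimes>\<^bsub>G\<^esub> \<gamma> \<otimes>\<^bsub>G\<^esub> inv\<^bsub>G\<^esub> \<eta>))"

definition displacement :: "'x set \<Rightarrow> ('x \<Rightarrow> 'x \<Rightarrow> real) \<Rightarrow> ('x \<Rightarrow> 'x) \<Rightarrow> real" where
  "displacement X d f = (INF x\<in>X. d x (f x))"

definition well_displacing ::
  "('g, 'm) monoid_scheme \<Rightarrow> 'g set \<Rightarrow> 'x set \<Rightarrow> ('x \<Rightarrow> 'x \<Rightarrow> real) \<Rightarrow> ('g \<Rightarrow> 'x \<Rightarrow> 'x) \<Rightarrow> bool" where
  "well_displacing G S X d act \<longleftrightarrow>
     (\<exists>A>0. \<exists>B>0. \<forall>\<gamma>\<in>carrier G.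
        displacement X d (act \<gamma>) \<ge> A * real (translation_length G S \<gamma>) - B)"

definition quasi_isometric_embedding ::
  "'a set \<Rightarrow> ('a \<Rightarrow> 'a \<Rightarrow> real) \<Rightarrow> 'b set \<Rightarrow> ('b \<Rightarrow> 'b \<Rightarrow> real) \<Rightarrow> ('a \<Rightarrow> 'b) \<Rightarrow> bool" where
  "quasi_isometric_embedding M d N e f \<longleftrightarrow>
     f \<in> M \<rightarrow> N \<and>
     (\<exists>A\<ge>1. \<exists>B\<ge>0. \<forall>x\<in>M. \<forall>y\<in>M.
        inverse A * d x y - B \<le> e (f x) (f y) \<and> e (f x) (f y) \<le> A * d x y + B)"

definition SL_group :: "('a::comm_ring_1^'n^'n) monoid" where
  "SL_group = \<lparr>carrier = {A. det A = 1}, mult = (**), one = mat 1\<rparr>"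

abbreviation SL_Z :: "(int^'n^'n) monoid" where "SL_Z \<equiv> SL_group"

abbreviation SL_R :: "(real^'n^'n) monoid" where "SL_R \<equiv> SL_group"

definition SO_R :: "(real^'n^'n) set" where
  "SO_R = {Q. rotation_matrix Q}"

definition sym_space :: "(real^'n^'n) set set" where
  "sym_space = lcosets\<^bsub>SL_R\<^esub> SO_R"

definition sym_space_act :: "int^'n^'n \<Rightarrow> (real^'n^'n) set \<Rightarrow> (real^'n^'n) set" where
  "sym_space_act \<gamma> p = map_matrix of_int \<gamma> <#\<^bsub>SL_R\<^esub> p"

text \<open>
  The tangent space of \<open>SL(n,\<real>)/SO(n)\<close> at the coset of \<open>g\<close> is identified, by left translation,
  with the quotient of the traceless matrices by the skew-symmetric ones, i.e. with the traceless
  symmetric matrices. The invariant Riemannian metric comes from the trace form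
  \<open>tr (X Y)\<close> on the latter; its norm is the Frobenius norm, which is the norm of \<^typ>\<open>real^'n^'n\<close>.
  So if \<open>c\<close> is a curve in \<open>SL(n,\<real>)\<close>, the speed of the projected curve \<open>t \<mapsto> c t SO(n)\<close> is the norm
  of the symmetric part of \<open>(c t)\<^sup>-\<^sup>1 c' t\<close>. Any other invariant Riemannian metric
  is a constant multiple of this one.
\<close>

definition sym_space_speed :: "(real \<Rightarrow> real^'n^'n) \<Rightarrow> real \<Rightarrow> real" where
  "sym_space_speed c t =
     (let A = matrix_inv (c t) ** vector_derivative c (at t)
      in norm ((1/2) *\<^sub>R (A + transpose A)))"

text \<open>
  Riemannian distance: the infimum of the lengths of curves. As \<open>SL(n,\<real>) \<rightarrow> SL(n,\<real>)/SO(n)\<close> is a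
  principal bundle, the piecewise \<open>C\<^sup>1\<close> curves of the quotient are the projections of those of
  \<open>SL(n,\<real>)\<close>. The predicate \<^const>\<open>valid_path\<close> does not bound the derivative near the break points;
  integrability of the speed has to be required because \<^const>\<open>integral\<close> is \<open>0\<close> on non-integrable
  functions.
\<close>

definition sym_space_curve_lengths ::
  "(real^'n^'n) set \<Rightarrow> (real^'n^'n) set \<Rightarrow> real set" where
  "sym_space_curve_lengths p q =
     {integral {0..1} (sym_space_speed c) | c.
        valid_path c \<and> path_image c \<subseteq> carrier SL_R \<and>
        pathstart c \<in> p \<and> pathfinish c \<in> q \<and>
        sym_space_speed c integrable_on {0..1}}"

definition sym_space_dist :: "(real^'n^'n) set \<Rightarrow> (real^'n^'n) set \<Rightarrow> real" where
  "sym_space_dist p q = Inf (sym_space_curve_lengths p q)"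

lemma det_map_of_int: "det (map_matrix of_int A :: real^'n^'n) = of_int (det A)"
  by (simp add: det_def)

lemma of_int_SL: "\<gamma> \<in> carrier SL_Z \<Longrightarrow> map_matrix of_int \<gamma> \<in> carrier SL_R"
  by (simp add: SL_group_def det_map_of_int)

lemma SL_invertible: "g \<in> carrier SL_R \<Longrightarrow> invertible g"
  by (simp add: SL_group_def invertible_det_nz)

lemma matrix_inv_SL:
  fixes g :: "real^'n^'n"
  assumes "g \<in> carrier SL_R"
  shows "matrix_inv g \<in> carrier SL_R" "matrix_inv g ** g = mat 1" "g ** matrix_inv g = mat 1"
proof -
  show 1: "matrix_inv g ** g = mat 1" "g ** matrix_inv g = mat 1"
    using someI_ex[OF SL_invertible[OF assms, unfolded invertible_def]]
    by (auto simp: matrix_inv_def)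
  have "det (matrix_inv g) * det g = 1"
    using arg_cong[OF 1(1), of det] by (simp add: det_mul)
  then show "matrix_inv g \<in> carrier SL_R"
    using assms by (simp add: SL_group_def)
qed

lemma group_SL_R: "group (SL_R :: (real^'n^'n) monoid)"
proof (rule groupI)
  fix g :: "real^'n^'n" assume "g \<in> carrier SL_R"
  then show "\<exists>h\<in>carrier SL_R. h \<otimes>\<^bsub>SL_R\<^esub> g = \<one>\<^bsub>SL_R\<^esub>"
    using matrix_inv_SL[of g] by (intro bexI[of _ "matrix_inv g"]) (auto simp: SL_group_def)
qed (auto simp: SL_group_def det_mul matrix_mul_assoc)

lemma SO_R_subset: "SO_R \<subseteq> carrier (SL_R :: (real^'n^'n) monoid)"
  by (auto simp: SO_R_def SL_group_def rotation_matrix_def)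

lemma sym_space_act_closed:
  fixes \<gamma> :: "int^'n^'n"
  assumes "\<gamma> \<in> carrier SL_Z" "p \<in> sym_space"
  shows "sym_space_act \<gamma> p \<in> sym_space"
proof -
  interpret group "SL_R :: (real^'n^'n) monoid" by (rule group_SL_R)
  obtain a where a: "a \<in> carrier SL_R" "p = a <#\<^bsub>SL_R\<^esub> SO_R"
    using assms(2) by (auto simp: sym_space_def LCOSETS_def)
  then have "sym_space_act \<gamma> p = (map_matrix of_int \<gamma> \<otimes>\<^bsub>SL_R\<^esub> a) <#\<^bsub>SL_R\<^esub> SO_R"
    using lcos_m_assoc[OF SO_R_subset of_int_SL[OF assms(1)] a(1)] by (simp add: sym_space_act_def)
  then show ?thesis
    using of_int_SL[OF assms(1)] a(1) by (auto simp: sym_space_def LCOSETS_def)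
qed

lemma bounded_linear_matrix_mult_left: "bounded_linear (\<lambda>x. (k :: real^'n^'n) ** (x :: real^'n^'n))"
  by (rule linear_conv_bounded_linear[THEN iffD1], rule linearI)
     (simp_all add: matrix_add_ldistrib matrix_scalar_ac flip: scalar_matrix_assoc)

lemma sym_space_speed_mult_left:
  fixes g :: "real^'n^'n" and c :: "real \<Rightarrow> real^'n^'n"
  assumes "g \<in> carrier SL_R" "c t \<in> carrier SL_R" "c differentiable at t"
  shows "sym_space_speed (\<lambda>t. g ** c t) t = sym_space_speed c t"
proof -
  have *: "vector_derivative (\<lambda>t. g ** c t) (at t) = g ** vector_derivative c (at t)"
    using assms(3)
    by (intro vector_derivative_at
          bounded_linear.has_vector_derivative[OF bounded_linear_matrix_mult_left])
       (simp add: vector_derivative_works)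
  have gc: "g ** c t \<in> carrier SL_R"
    using assms by (simp add: SL_group_def det_mul)
  have "matrix_inv (g ** c t) ** g = matrix_inv (g ** c t) ** (g ** c t) ** matrix_inv (c t)"
    by (simp add: matrix_inv_SL(3)[OF assms(2)] flip: matrix_mul_assoc)
  also have "\<dots> = matrix_inv (c t)"
    by (simp add: matrix_inv_SL(2)[OF gc])
  finally have "matrix_inv (g ** c t) ** (g ** v) = matrix_inv (c t) ** v" for v :: "real^'n^'n"
    by (simp add: matrix_mul_assoc)
  then show ?thesis
    unfolding sym_space_speed_def * by (simp only: Let_def)
qed

lemma sym_space_curve_lengths_mult_left:
  fixes g :: "real^'n^'n"
  assumes g: "g \<in> carrier SL_R"
  shows "sym_space_curve_lengths p q
           \<subseteq> sym_space_curve_lengths (g <#\<^bsub>SL_R\<^esub> p) (g <#\<^bsub>SL_R\<^esub> q)"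
proof
  fix l assume "l \<in> sym_space_curve_lengths p q"
  then obtain c where l: "l = integral {0..1} (sym_space_speed c)"
    and c: "valid_path c" "path_image c \<subseteq> carrier SL_R" "pathstart c \<in> p" "pathfinish c \<in> q"
      "sym_space_speed c integrable_on {0..1}"
    by (auto simp: sym_space_curve_lengths_def)
  let ?c = "\<lambda>t. g ** c t"
  obtain F where F: "finite F" "c C1_differentiable_on ({0..1} - F)"
    using c(1) by (auto simp: valid_path_def piecewise_C1_differentiable_on_def)
  have eq: "sym_space_speed ?c t = sym_space_speed c t" if "t \<in> {0..1} - F" for t
    using that F(2) c(2)
    by (intro sym_space_speed_mult_left[OF g]) (auto simp: C1_differentiable_on_eq path_image_def)
  obtain D where D: "\<forall>t\<in>{0..1} - F. (c has_vector_derivative D t) (at t)"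
      "continuous_on ({0..1} - F) D"
    using F(2) by (auto simp: C1_differentiable_on_def)
  have "?c C1_differentiable_on ({0..1} - F)"
    unfolding C1_differentiable_on_def
    using D by (intro exI[of _ "\<lambda>t. g ** D t"])
      (auto intro!: bounded_linear.has_vector_derivative[OF bounded_linear_matrix_mult_left]
         bounded_linear.continuous_on[OF bounded_linear_matrix_mult_left])
  moreover have "continuous_on {0..1} ?c"
    using c(1) by (intro bounded_linear.continuous_on[OF bounded_linear_matrix_mult_left])
      (simp add: valid_path_def piecewise_C1_differentiable_on_def)
  ultimately have "valid_path ?c"
    using F(1) by (auto simp: valid_path_def piecewise_C1_differentiable_on_def)
  moreover have "path_image ?c \<subseteq> carrier SL_R"
    using c(2) g by (auto simp: path_image_def SL_group_def det_mul)
  moreover have "pathstart ?c \<in> g <#\<^bsub>SL_R\<^esub> p" "pathfinish ?c \<in> g <#\<^bsub>SL_R\<^esub> q"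
    using c(3,4) by (auto simp: l_coset_def SL_group_def pathstart_def pathfinish_def)
  moreover have "sym_space_speed ?c integrable_on {0..1}"
    by (rule integrable_spike_finite[OF F(1) eq c(5)])
  moreover have "integral {0..1} (sym_space_speed ?c) = l"
    unfolding l by (rule integral_spike[OF negligible_finite[OF F(1)] eq[symmetric]])
  ultimately show "l \<in> sym_space_curve_lengths (g <#\<^bsub>SL_R\<^esub> p) (g <#\<^bsub>SL_R\<^esub> q)"
    by (auto simp: sym_space_curve_lengths_def)
qed

lemma sym_space_act_isometry:
  fixes \<gamma> :: "int^'n^'n"
  assumes "\<gamma> \<in> carrier SL_Z" "p \<in> sym_space" "q \<in> sym_space"
  shows "sym_space_dist (sym_space_act \<gamma> p) (sym_space_act \<gamma> q) = sym_space_dist p q"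
proof -
  interpret group "SL_R :: (real^'n^'n) monoid" by (rule group_SL_R)
  let ?g = "map_matrix of_int \<gamma> :: real^'n^'n"
  note g = of_int_SL[OF assms(1)]
  have sub: "r \<subseteq> carrier SL_R" if "r \<in> sym_space" for r :: "(real^'n^'n) set"
    using that l_coset_subset_G[OF SO_R_subset] by (auto simp: sym_space_def LCOSETS_def)
  have inv: "inv\<^bsub>SL_R\<^esub> ?g <#\<^bsub>SL_R\<^esub> (?g <#\<^bsub>SL_R\<^esub> r) = r" if "r \<in> sym_space" for r
    using sub[OF that] g by (simp add: lcos_m_assoc lcos_mult_one)
  have "sym_space_curve_lengths (?g <#\<^bsub>SL_R\<^esub> p) (?g <#\<^bsub>SL_R\<^esub> q) = sym_space_curve_lengths p q"
    using sym_space_curve_lengths_mult_left[OF g, of p q]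
      sym_space_curve_lengths_mult_left[OF inv_closed[OF g], of "?g <#\<^bsub>SL_R\<^esub> p" "?g <#\<^bsub>SL_R\<^esub> q"]
    by (simp add: inv assms)
  then show ?thesis
    by (simp add: sym_space_dist_def sym_space_act_def)
qed

end

theory Submission
  imports Defs
begin

text \<open>
  Not well displacing: the transvection \<open>1 + k E\<^sub>i\<^sub>j\<close> moves the coset of the diagonal matrix with
  entries \<open>k\<close>, \<open>1/k\<close> at \<open>i\<close>, \<open>j\<close> by at most 1, whereas every integral conjugate of it has an entry of
  absolute value at least \<open>k - 1\<close>, so its translation length is at least of order \<open>log k\<close>.

  Orbit maps: the norm of \<open>\<gamma>\<close> is at most exponential in the distance from a point to its image, so one
  needs that \<open>\<gamma>\<close> is a product of \<open>O(log \<parallel>\<gamma>\<parallel>)\<close> elementary matrices (Lubotzky, Mozes and Raghunathan).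
  For \<open>n \<ge> 3\<close> the transvection by \<open>k\<close> has length \<open>O(log k)\<close>, since a hyperbolic element of \<open>SL(2,\<int>)\<close>
  acts on a subgroup \<open>\<int>\<^sup>2\<close> of transvections. In the Euclidean algorithm for a pair of entries of a column the
  logarithms of the quotients add up to at most a multiple of the logarithm of the entries, so each of the boundedly many runs
  in Gaussian elimination costs only \<open>O(log \<parallel>\<gamma>\<parallel>)\<close> letters.
\<close>

subsection \<open>Words in elementary matrices\<close>

text \<open>The entry \<open>k\<close> is added to that of the identity instead of replacing it, so
  the row operation formula \<open>transv_mult\<close> holds even for \<open>i = j\<close>, where
  the matrix is not a transvection.\<close>

definition transv :: "'n \<Rightarrow> 'n \<Rightarrow> 'a \<Rightarrow> 'a::comm_ring_1^'n^'n" where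
  "transv i j k = (\<chi> a b. (if a = b then 1 else 0) + (if a = i \<and> b = j then k else 0))"

lemma transv_mult:
  fixes M :: "'a::comm_ring_1^'n^'n"
  shows "(transv i j k ** M) $ a = (if a = i then M $ i + k *s M $ j else M $ a)"
proof -
  have "(\<Sum>c\<in>UNIV. ((if a = c then 1 else 0) + (if a = i \<and> c = j then k else 0)) * M $ c $ b)
      = (\<Sum>c\<in>UNIV. (if a = c then M $ c $ b else 0)) + (\<Sum>c\<in>UNIV. if c = j then (if a = i then k * M $ c $ b else 0) else 0)" for b
    unfolding sum.distrib[symmetric] by (rule sum.cong) (auto simp: distrib_right)
  then show ?thesis
    by (auto simp: vec_eq_iff transv_def matrix_matrix_mult_def)
qed

lemma transv_mult_nth:
  fixes M :: "'a::comm_ring_1^'n^'n"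
  shows "(transv i j k ** M) $ a $ b = (if a = i then M $ i $ b + k * M $ j $ b else M $ a $ b)"
  by (simp add: transv_mult)

text \<open>The factor \<open>mat 1\<close> at the right end gives a product of transvections
  something to act on: identities between words become computations with successive row operations
  on the identity.\<close>

lemma matrix_eqI_mult:
  fixes A B :: "'a::comm_ring_1^'n^'n"
  assumes "\<And>a b. (A ** mat 1) $ a $ b = (B ** mat 1) $ a $ b"
  shows "A = B"
  using assms by (simp add: vec_eq_iff)

lemma transv_zero [simp]: "transv i j 0 = mat 1"
  by (simp add: transv_def mat_def vec_eq_iff)

lemma transv_add:
  assumes "i \<noteq> j"
  shows "transv i j a ** transv i j b = transv i j (a + b)"
  by (rule matrix_eqI_mult)
     (use assms in \<open>auto simp: transv_mult_nth algebra_simps simp del: matrix_mul_rid simp flip: matrix_mul_assoc\<close>)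

lemma det_transv:
  assumes "i \<noteq> j"
  shows "det (transv i j k :: 'a::comm_ring_1^'n^'n) = 1"
proof -
  have "(transv i j k :: 'a^'n^'n) =
      (\<chi> a. if a = i then row i (mat 1) + k *s row j (mat 1) else row a (mat 1))"
    by (auto simp: vec_eq_iff transv_def mat_def row_def)
  then show ?thesis
    using det_row_operation[OF assms, of "mat 1 :: 'a^'n^'n" k] by simp
qed

lemma matrix_inverse_unique:
  fixes g :: "'a::comm_ring_1^'n^'n"
  assumes "h ** g = mat 1" "g ** h' = mat 1"
  shows "h = h'"
  by (metis assms matrix_mul_assoc matrix_mul_lid matrix_mul_rid)

text \<open>The rule \<open>weaken\<close> makes the index an upper bound for the length. This takes
  the place of a word metric and makes sense before elementary matrices are known to generate the
  group.\<close>

inductive elem_word :: "nat \<Rightarrow> int^'n^'n \<Rightarrow> bool" where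
  one: "elem_word 0 (mat 1)"
| mult: "\<lbrakk>elem_word N g; i \<noteq> j; k \<in> {1, -1}\<rbrakk> \<Longrightarrow> elem_word (Suc N) (transv i j k ** g)"
| weaken: "elem_word N g \<Longrightarrow> elem_word (Suc N) g"

lemma elem_word_mono:
  assumes "elem_word N g" "N \<le> N'"
  shows "elem_word N' g"
  using assms(2,1) by (induction rule: dec_induct) (auto intro: elem_word.weaken)

lemma elem_word_mult:
  assumes "elem_word M g" "elem_word N h"
  shows "elem_word (M + N) (g ** h)"
  using assms by induction (auto simp flip: matrix_mul_assoc intro: elem_word.intros)

lemma elem_word_transv:
  assumes "i \<noteq> j" "k \<in> {1, -1}"
  shows "elem_word 1 (transv i j k)"
  using elem_word.mult[OF elem_word.one assms] by simp

text \<open>The letters are closed under inversion, so the reversed word of inverse letters is no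
  longer.\<close>

lemma elem_word_inverse:
  assumes "elem_word N g"
  obtains h where "elem_word N h" "h ** g = mat 1" "g ** h = mat 1"
proof -
  have "\<exists>h. elem_word N h \<and> h ** g = mat 1 \<and> g ** h = mat 1"
    using assms
  proof induction
    case one
    show ?case
      by (intro exI[of _ "mat 1"]) (simp add: elem_word.one)
  next
    case (mult N g i j k)
    then obtain h where h: "elem_word N h" "h ** g = mat 1" "g ** h = mat 1"
      by blast
    have t: "transv i j k ** transv i j (- k) = mat 1" "transv i j (- k) ** transv i j k = mat 1"
      using mult by (auto simp: transv_add)
    have "elem_word (N + 1) (h ** transv i j (- k))"
      using mult by (intro elem_word_mult h elem_word_transv) auto
    moreover have "(h ** transv i j (- k)) ** (transv i j k ** g) = h ** (transv i j (- k) ** transv i j k) ** g"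
      by (simp only: matrix_mul_assoc)
    moreover have "(transv i j k ** g) ** (h ** transv i j (- k)) = transv i j k ** (g ** h) ** transv i j (- k)"
      by (simp only: matrix_mul_assoc)
    ultimately show ?case
      using h t by (intro exI[of _ "h ** transv i j (- k)"]) simp
  next
    case (weaken N g)
    then show ?case by (blast intro: elem_word.weaken)
  qed
  then show thesis using that by blast
qed

lemma elem_word_left_inverse:
  assumes "elem_word N g" "h ** g = mat 1"
  shows "elem_word N h"
  by (metis assms elem_word_inverse matrix_inverse_unique)

lemma elem_word_right_inverse:
  assumes "elem_word N g" "g ** h = mat 1"
  shows "elem_word N h"
  by (metis assms elem_word_inverse matrix_inverse_unique)

lemma det_elem_word: "elem_word N g \<Longrightarrow> det g = 1"
  by (induction rule: elem_word.induct) (auto simp: det_mul det_transv)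

text \<open>Sizes are counted in bits to be comparable with word lengths: a letter adds or subtracts
  one row to or from another, so it at most doubles the largest absolute value and costs one
  bit.\<close>

definition entry_bound :: "nat \<Rightarrow> int^'n^'n \<Rightarrow> bool" where
  "entry_bound m M \<longleftrightarrow> (\<forall>a b. \<bar>M $ a $ b\<bar> \<le> 2 ^ m)"

lemma entry_boundD: "entry_bound m M \<Longrightarrow> \<bar>M $ a $ b\<bar> \<le> 2 ^ m"
  by (simp add: entry_bound_def)

lemma entry_bound_elem_word:
  assumes "elem_word N g" "entry_bound m M"
  shows "entry_bound (m + N) (g ** M)"
  using assms
proof induction
  case (mult N g i j k)
  have "\<bar>(transv i j k ** (g ** M)) $ a $ b\<bar> \<le> 2 ^ (m + N) + 2 ^ (m + N)" for a b
    using mult entry_boundD[OF mult.IH, of i b] entry_boundD[OF mult.IH, of j b]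
      entry_boundD[OF mult.IH, of a b]
    by (auto simp: transv_mult_nth)
  then show ?case
    by (simp add: entry_bound_def flip: matrix_mul_assoc)
next
  case (weaken N g)
  then have "\<bar>(g ** M) $ a $ b\<bar> \<le> 2 ^ (m + N)" for a b
    by (auto simp: entry_bound_def)
  then have "\<bar>(g ** M) $ a $ b\<bar> \<le> 2 * 2 ^ (m + N)" for a b
    by (rule order_trans) simp
  then show ?case by (simp add: entry_bound_def)
qed simp

text \<open>
  The orbit of \<open>(1, 0)\<close> under the hyperbolic matrix with rows \<open>(2, 1)\<close> and \<open>(1, 1)\<close>. Its second
  coordinates are the Fibonacci numbers of even index: they grow exponentially with ratio at most 3,
  so every natural number has an expansion in them with digits 0, 1, 2.
\<close>

fun hyp_orbit :: "nat \<Rightarrow> int \<times> int" where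
  "hyp_orbit 0 = (1, 0)"
| "hyp_orbit (Suc n) = (let (x, y) = hyp_orbit n in (2 * x + y, x + y))"

abbreviation hyp_x :: "nat \<Rightarrow> int" where "hyp_x n \<equiv> fst (hyp_orbit n)"
abbreviation hyp_y :: "nat \<Rightarrow> int" where "hyp_y n \<equiv> snd (hyp_orbit n)"

lemma hyp_Suc: "hyp_x (Suc n) = 2 * hyp_x n + hyp_y n" "hyp_y (Suc n) = hyp_x n + hyp_y n"
  by (simp_all add: case_prod_unfold Let_def)

lemma hyp_bounds: "0 \<le> hyp_y n \<and> hyp_y n \<le> hyp_x n"
  by (induction n) (auto simp: hyp_Suc simp del: hyp_orbit.simps(2))

text \<open>The bound starts at index 1, because \<open>hyp_y 0 = 0\<close> and
  \<open>hyp_y 1 = 1\<close>.\<close>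

lemma hyp_y_le_triple: "hyp_y (Suc (Suc n)) \<le> 3 * hyp_y (Suc n)"
  using hyp_bounds[of n] by (simp add: hyp_Suc del: hyp_orbit.simps(2))

text \<open>As \<open>hyp_x\<close> dominates \<open>hyp_y\<close>, each step at least doubles the
  second coordinate. Hence logarithmically many digits suffice.\<close>

lemma hyp_y_ge_power: "2 ^ n \<le> hyp_y (Suc n)"
proof (induction n)
  case (Suc n)
  then show ?case using hyp_bounds[of "Suc n"] by (simp only: hyp_Suc(2)[of "Suc n"] power_Suc) linarith
qed simp

text \<open>Greedy expansion: the top digit is the quotient by \<open>hyp_y m\<close>, which is
  below 3 by \<open>hyp_y_le_triple\<close>, and the remainder has the lower digits.\<close>

lemma hyp_digits:
  assumes "0 \<le> k" "k < hyp_y m"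
  obtains d where "\<And>i. d i \<in> {0, 1, 2}" "k = (\<Sum>i<m. d i * hyp_y i)"
proof -
  have "\<exists>d. (\<forall>i. d i \<in> {0, 1, 2}) \<and> k = (\<Sum>i<m. d i * hyp_y i)"
    using assms
  proof (induction m arbitrary: k)
    case (Suc m)
    show ?case
    proof (cases m)
      case 0
      \<comment> \<open>Here \<open>k < hyp_y 1 = 1\<close>, so \<open>k = 0\<close>.\<close>
      then show ?thesis using Suc.prems by (intro exI[of _ "\<lambda>_. 0"]) auto
    next
      case (Suc m')
      have pos: "0 < hyp_y m"
        using hyp_y_ge_power[of m'] Suc by (smt (verit) zero_less_power)
      have k3: "k < 3 * hyp_y m"
        using Suc.prems hyp_y_le_triple[of m'] Suc by (auto simp del: hyp_orbit.simps)
      have "k div hyp_y m * hyp_y m < 3 * hyp_y m"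
        using k3 pos_mod_sign[OF pos, of k] div_mult_mod_eq[of k "hyp_y m"] by linarith
      then have q: "k div hyp_y m < 3" "0 \<le> k div hyp_y m"
        using pos Suc.prems(1) by (auto simp: pos_imp_zdiv_nonneg_iff)
      obtain d where d: "\<forall>i. d i \<in> {0, 1, 2}" "k mod hyp_y m = (\<Sum>i<m. d i * hyp_y i)"
        using Suc.IH[of "k mod hyp_y m"] pos by (auto simp del: hyp_orbit.simps)
      have "(\<Sum>i<Suc m. (d(m := k div hyp_y m)) i * hyp_y i) = (\<Sum>i<m. d i * hyp_y i) + k div hyp_y m * hyp_y m"
        by (simp del: hyp_orbit.simps)
      also have "\<dots> = k"
        by (simp add: d(2)[symmetric] del: hyp_orbit.simps)
      finally show ?thesis
        using q d(1) by (intro exI[of _ "d(m := k div hyp_y m)"]) auto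
    qed
  qed simp
  then show thesis using that by blast
qed

text \<open>
  Horner's scheme: conjugation by the hyperbolic matrix in rows \<open>i\<close>, \<open>l\<close> acts linearly on column \<open>j\<close>.
\<close>

lemma elem_word_hyp:
  fixes i j l :: "'n::finite"
  assumes dist: "i \<noteq> j" "l \<noteq> j" "i \<noteq> l" and d: "\<And>r. d r \<in> {0, 1, 2}"
  shows "elem_word (6 * m) (transv i j (\<Sum>r<m. d r * hyp_x r) ** transv l j (\<Sum>r<m. d r * hyp_y r))"
  using d
proof (induction m arbitrary: d)
  case 0
  show ?case using elem_word.one by simp
next
  case (Suc m)
  let ?V = "\<lambda>x y. transv i j x ** transv l j y :: int^'n^'n"
  define x where "x = (\<Sum>r<m. d (Suc r) * hyp_x r)"
  define y where "y = (\<Sum>r<m. d (Suc r) * hyp_y r)"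
  \<comment> \<open>In rows \<open>i\<close>, \<open>l\<close> this is the hyperbolic matrix with
    rows \<open>(2, 1)\<close> and \<open>(1, 1)\<close>; \<open>?A'\<close> is its inverse.\<close>
  let ?A = "transv i l 1 ** transv l i 1 :: int^'n^'n"
  let ?A' = "transv l i (-1) ** transv i l (-1) :: int^'n^'n"
  have V: "elem_word (6 * m) (?V x y)"
    unfolding x_def y_def by (rule Suc.IH) (rule Suc.prems)
  have A: "elem_word (1 + 1) ?A" "elem_word (1 + 1) ?A'"
    by (intro elem_word_mult elem_word_transv; use dist in auto)+
  \<comment> \<open>The orbit starts at \<open>(1, 0)\<close>, so the lowest digit contributes only
    to row \<open>i\<close>. Two letters for it and two each for \<open>?A\<close> and
    \<open>?A'\<close> give the 6 letters per digit.\<close>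
  have "elem_word (1 + 1) (transv i j (d 0))"
  proof -
    consider "d 0 = 0" | "d 0 = 1" | "d 0 = 2" using Suc.prems[of 0] by auto
    then show ?thesis
    proof cases
      case 3
      then have "transv i j (d 0) = transv i j 1 ** transv i j 1"
        using dist by (simp add: transv_add)
      then show ?thesis using dist by (simp only:) (intro elem_word_mult elem_word_transv; simp)
    next
      case 2
      then show ?thesis using elem_word.weaken[OF elem_word_transv[of i j 1]] dist by simp
    qed (use elem_word_mono[OF elem_word.one] in auto)
  qed
  then have "elem_word (1 + 1 + (1 + 1 + (6 * m + (1 + 1)))) (transv i j (d 0) ** (?A ** (?V x y ** ?A')))"
    by (intro elem_word_mult A V)
  moreover have "transv i j (d 0) ** (?A ** (?V x y ** ?A')) = ?V (d 0 + (2 * x + y)) (x + y)"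
    by (rule matrix_eqI_mult)
       (use dist in \<open>auto simp: transv_mult_nth algebra_simps simp del: matrix_mul_rid simp flip: matrix_mul_assoc\<close>)
  moreover have "(\<Sum>r<Suc m. d r * hyp_x r) = d 0 + (2 * x + y)"
    by (simp only: sum.lessThan_Suc_shift hyp_Suc x_def y_def)
       (simp add: algebra_simps sum.distrib sum_distrib_left)
  moreover have "(\<Sum>r<Suc m. d r * hyp_y r) = x + y"
    by (simp only: sum.lessThan_Suc_shift hyp_Suc x_def y_def)
       (simp add: algebra_simps sum.distrib sum_distrib_left)
  moreover have "1 + 1 + (1 + 1 + (6 * m + (1 + 1))) = 6 * Suc m" by simp
  ultimately show ?case by (simp only:)
qed

text \<open>
  The commutator of \<open>transv i l 1\<close> with \<open>transv i j x ** transv l j k\<close> is \<open>transv i j k\<close>, which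
  discards the uncontrolled coordinate \<open>x\<close>.
\<close>

lemma elem_word_transv_log:
  fixes i j :: "'n::finite"
  assumes "i \<noteq> j" and card: "CARD('n) \<ge> 3" and k: "\<bar>k\<bar> \<le> 2 ^ m"
  shows "elem_word (26 * (m + 1)) (transv i j k)"
proof -
  \<comment> \<open>The hyperbolic matrix acts on rows \<open>i\<close> and \<open>l\<close> and
    fixes the index \<open>j\<close>; it therefore needs three different indices, which is where
    dimension at least 3 enters.\<close>
  have "card {i, j} \<le> 2"
    by (simp add: card_insert_if)
  then have "{i, j} \<noteq> UNIV"
    using card by auto
  then obtain l where l: "l \<noteq> i" "l \<noteq> j" by blast
  have nonneg: "elem_word (26 * (m + 1)) (transv i j k)" if k: "0 \<le> k" "k \<le> 2 ^ m" for k
  proof -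
    \<comment> \<open>Index \<open>m + 1\<close> would give only
      \<open>2 ^ m \<le> hyp_y (m + 1)\<close>; one more makes the inequality strict when
      \<open>k = 2 ^ m\<close>.\<close>
    have "k < hyp_y (Suc (Suc m))"
      using k(2) hyp_y_ge_power[of "Suc m"] zero_less_power[of "2::int" m] by (simp only: power_Suc) linarith
    then obtain d where d: "\<And>r. d r \<in> {0, 1, 2}" "k = (\<Sum>r<Suc (Suc m). d r * hyp_y r)"
      using hyp_digits[OF k(1)] by blast
    define x where "x = (\<Sum>r<Suc (Suc m). d r * hyp_x r)"
    let ?V = "transv i j x ** transv l j k :: int^'n^'n"
    have V: "elem_word (6 * Suc (Suc m)) ?V"
      unfolding d(2) x_def by (rule elem_word_hyp) (use l assms(1) d(1) in blast)+
    obtain h where h: "elem_word (6 * Suc (Suc m)) h" "?V ** h = mat 1"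
      using elem_word_inverse[OF V] by metis
    have "elem_word (1 + (6 * Suc (Suc m) + (1 + 6 * Suc (Suc m))))
        (transv i l 1 ** (?V ** (transv i l (-1) ** h)))"
      using l by (intro elem_word_mult[OF elem_word_transv] elem_word_mult[OF V] elem_word_mult[OF elem_word_transv h(1)]) auto
    moreover have "transv i l 1 ** (?V ** transv i l (-1)) = transv i j k ** ?V"
      by (rule matrix_eqI_mult)
         (use l assms(1) in \<open>auto simp: transv_mult_nth algebra_simps simp del: matrix_mul_rid simp flip: matrix_mul_assoc\<close>)
    then have "transv i l 1 ** (?V ** (transv i l (-1) ** h)) = transv i j k ** (?V ** h)"
      by (simp only: matrix_mul_assoc)
    ultimately have "elem_word (1 + (6 * Suc (Suc m) + (1 + 6 * Suc (Suc m)))) (transv i j k)"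
      by (simp only: h(2) matrix_mul_rid)
    \<comment> \<open>The commutator has \<open>12 * m + 26\<close> letters.\<close>
    then show ?thesis
      by (rule elem_word_mono) simp
  qed
  show ?thesis
  proof (cases "k \<ge> 0")
    case True
    then show ?thesis using nonneg k by auto
  next
    case False
    then have "elem_word (26 * (m + 1)) (transv i j (- k))"
      using nonneg[of "- k"] k by auto
    then show ?thesis
      by (rule elem_word_left_inverse) (use assms(1) in \<open>simp add: transv_add\<close>)
  qed
qed

subsection \<open>Gaussian elimination\<close>

text \<open>Two consequences of being supported on the block of \<open>i\<close> and
  \<open>j\<close>: other rows are fixed, and a column that vanishes in both rows keeps doing so.
  They are stable under products and suffice to protect columns already reduced.\<close>

definition acts_on_rows :: "'n \<Rightarrow> 'n \<Rightarrow> int^'n^'n \<Rightarrow> bool" where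
  "acts_on_rows i j g \<longleftrightarrow>
     (\<forall>M :: int^'n^'n. (\<forall>a. a \<noteq> i \<and> a \<noteq> j \<longrightarrow> (g ** M) $ a = M $ a) \<and>
          (\<forall>d. M $ i $ d = 0 \<and> M $ j $ d = 0 \<longrightarrow> (g ** M) $ i $ d = 0 \<and> (g ** M) $ j $ d = 0))"

lemma acts_on_rows_one: "acts_on_rows i j (mat 1)"
  by (simp add: acts_on_rows_def)

lemma acts_on_rows_transv: "acts_on_rows i j (transv i j k)" "acts_on_rows i j (transv j i k)"
  by (auto simp: acts_on_rows_def transv_mult_nth transv_mult)

lemma acts_on_rows_mult:
  assumes "acts_on_rows i j g" "acts_on_rows i j h"
  shows "acts_on_rows i j (g ** h)"
  using assms by (simp add: acts_on_rows_def flip: matrix_mul_assoc)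

lemma acts_on_rows_sym: "acts_on_rows i j g \<longleftrightarrow> acts_on_rows j i g"
  by (auto simp: acts_on_rows_def)

lemma acts_on_rows_other: "\<lbrakk>acts_on_rows i j g; a \<noteq> i; a \<noteq> j\<rbrakk> \<Longrightarrow> (g ** M) $ a = (M :: int^'n^'n) $ a"
  by (simp add: acts_on_rows_def)

lemma acts_on_rows_zero:
  fixes M :: "int^'n^'n"
  shows "\<lbrakk>acts_on_rows i j g; M $ i $ d = 0; M $ j $ d = 0\<rbrakk> \<Longrightarrow> (g ** M) $ i $ d = 0 \<and> (g ** M) $ j $ d = 0"
  by (simp add: acts_on_rows_def)

text \<open>With the signs put into the multiplier, a single row operation performs division with
  remainder on absolute values.\<close>

lemma signed_quotient:
  fixes x y :: int
  shows "\<bar>x - sgn x * sgn y * (\<bar>x\<bar> div \<bar>y\<bar>) * y\<bar> = \<bar>x\<bar> mod \<bar>y\<bar>"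
proof -
  have "x - sgn x * sgn y * (\<bar>x\<bar> div \<bar>y\<bar>) * y = sgn x * (\<bar>x\<bar> - \<bar>x\<bar> div \<bar>y\<bar> * \<bar>y\<bar>)"
    by (simp add: algebra_simps abs_sgn)
  also have "\<bar>x\<bar> - \<bar>x\<bar> div \<bar>y\<bar> * \<bar>y\<bar> = \<bar>x\<bar> mod \<bar>y\<bar>"
    by (simp add: minus_div_mult_eq_mod)
  finally show ?thesis
    by (cases "x = 0"; cases "y = 0") (auto simp: abs_mult)
qed

text \<open>
  The potential \<open>\<bar>x\<bar> * \<bar>y\<bar>\<close> drops by a factor at least \<open>q + 1\<close> in a division step with quotient \<open>q\<close>,
  which pays for the \<open>O(log q)\<close> letters of that step.
\<close>

lemma euclid_rows:
  fixes M :: "int^'n^'n"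
  assumes card: "CARD('n) \<ge> 3" and "i \<noteq> j"
    and "\<bar>M $ j $ c\<bar> \<le> \<bar>M $ i $ c\<bar>" "\<bar>M $ i $ c\<bar> * \<bar>M $ j $ c\<bar> < 2 ^ m"
  obtains g where "elem_word (78 * m) g" "acts_on_rows i j g" "(g ** M) $ i $ c = 0 \<or> (g ** M) $ j $ c = 0"
proof -
  have "\<exists>g. elem_word (78 * m) g \<and> acts_on_rows i j g \<and> ((g ** M) $ i $ c = 0 \<or> (g ** M) $ j $ c = 0)"
    using assms(2-)
  proof (induction m arbitrary: i j M rule: less_induct)
    case (less m)
    define x y where "x = M $ i $ c" and "y = M $ j $ c"
    show ?case
    proof (cases "y = 0")
      case True
      then show ?thesis
        using elem_word_mono[OF elem_word.one] acts_on_rows_one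
        by (intro exI[of _ "mat 1"]) (auto simp: y_def)
    next
      case False
      define q where "q = \<bar>x\<bar> div \<bar>y\<bar>"
      define k where "k = - (sgn x * sgn y * q)"
      define r where "r = \<bar>x\<bar> mod \<bar>y\<bar>"
      have q: "1 \<le> q"
        using less.prems False pos_imp_zdiv_pos_iff[of "\<bar>y\<bar>" "\<bar>x\<bar>"] by (auto simp: q_def x_def y_def)
      have r: "0 \<le> r" "r < \<bar>y\<bar>"
        using False by (auto simp: r_def)
      have xqr: "\<bar>x\<bar> = q * \<bar>y\<bar> + r"
        by (simp add: q_def r_def)
      have xy: "\<bar>x\<bar> * \<bar>y\<bar> < 2 ^ m"
        using less.prems by (simp add: x_def y_def)
      \<comment> \<open>\<open>t\<close> is the integral part of the binary logarithm of
        \<open>q + 1\<close>. It is positive because \<open>q \<ge> 1\<close>, so every division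
        step uses up part of the budget \<open>m\<close>.\<close>
      have "1 \<le> nat (q + 1)" using q by simp
      from ex_power_ivl1[OF order_refl this]
      obtain t where "2 ^ t \<le> nat (q + 1)" "nat (q + 1) < 2 ^ (t + 1)" by blast
      then have "int (2 ^ t) \<le> int (nat (q + 1))" "int (nat (q + 1)) < int (2 ^ (t + 1))"
        by (simp_all only: of_nat_le_iff of_nat_less_iff)
      then have t: "2 ^ t \<le> q + 1" "q + 1 < 2 ^ Suc t"
        using q by simp_all
      have "t \<noteq> 0"
        using t(2) q by (intro notI) simp
      then have t1: "1 \<le> t" by simp
      have k: "\<bar>k\<bar> \<le> 2 ^ Suc t"
        using t q False by (auto simp: k_def abs_mult abs_sgn_eq)
      have "elem_word (26 * (Suc t + 1)) (transv i j k)"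
        by (rule elem_word_transv_log[OF less.prems(1) card k])
      \<comment> \<open>Since \<open>t \<ge> 1\<close>, \<open>26 * (t + 2) \<le> 78 * t\<close>;
        this is the origin of the constant 78.\<close>
      then have T: "elem_word (78 * t) (transv i j k)"
        by (rule elem_word_mono) (use t1 in simp)
      have new: "\<bar>(transv i j k ** M) $ i $ c\<bar> = r" "(transv i j k ** M) $ j $ c = y"
        using signed_quotient[of x y] less.prems(1)
        by (auto simp: transv_mult_nth k_def r_def q_def x_def y_def)
      \<comment> \<open>From \<open>r < \<bar>y\<bar>\<close> follows
        \<open>q * r + r \<le> q * \<bar>y\<bar> + r = \<bar>x\<bar>\<close>; replacing
        \<open>\<bar>x\<bar>\<close> by \<open>r\<close> in the potential thus gains the factor
        \<open>q + 1\<close>.\<close>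
      have yr: "(q + 1) * r \<le> \<bar>x\<bar>"
        using r q xqr mult_left_mono[of r "\<bar>y\<bar>" q] by (simp add: algebra_simps)
      show ?thesis
      proof (cases "r = 0")
        case True
        \<comment> \<open>In the last division the potential drops to 0, so the factor argument is
          replaced by \<open>q \<le> \<bar>x\<bar> * \<bar>y\<bar> < 2 ^ m\<close>, which gives
          \<open>t \<le> m\<close>.\<close>
        have "q * 1 \<le> \<bar>x\<bar> * \<bar>y\<bar>"
        proof (rule mult_mono)
          have "q * 1 \<le> q * \<bar>y\<bar>" using False q by (intro mult_left_mono) auto
          then show "q \<le> \<bar>x\<bar>" using xqr r by simp
        qed (use False q in auto)
        then have "q < 2 ^ m" using xy by simp
        then have "q + 1 \<le> 2 ^ m" by simp
        then have "(2::int) ^ t \<le> 2 ^ m" using t by linarith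
        then have "t \<le> m" by simp
        then have "elem_word (78 * m) (transv i j k)"
          by (intro elem_word_mono[OF T]) simp
        then show ?thesis
          using True new acts_on_rows_transv by (intro exI[of _ "transv i j k"]) auto
      next
        case False
        then have rpos: "1 \<le> r" using r by simp
        have "2 ^ t * (r * \<bar>y\<bar>) \<le> (q + 1) * (r * \<bar>y\<bar>)"
          using t r by (intro mult_right_mono) auto
        also have "\<dots> = ((q + 1) * r) * \<bar>y\<bar>" by simp
        also have "\<dots> \<le> \<bar>x\<bar> * \<bar>y\<bar>" using yr by (intro mult_right_mono) auto
        finally have "2 ^ t * (r * \<bar>y\<bar>) < 2 ^ m" using xy by simp
        moreover have "1 \<le> r * \<bar>y\<bar>"
          using rpos r mult_mono[of 1 r 1 "\<bar>y\<bar>"] by auto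
        then have "(2::int) ^ t * 1 \<le> 2 ^ t * (r * \<bar>y\<bar>)"
          by (rule mult_left_mono) simp
        ultimately have "(2::int) ^ t < 2 ^ m" by linarith
        then have tm: "t < m" by simp
        have "(2::int) ^ m = 2 ^ t * 2 ^ (m - t)"
          using tm by (simp flip: power_add)
        then have "r * \<bar>y\<bar> < 2 ^ (m - t)"
          using \<open>2 ^ t * (r * \<bar>y\<bar>) < 2 ^ m\<close> by (simp add: mult_less_cancel_left)
        \<comment> \<open>The remainder in row \<open>i\<close> is now the smaller entry, so the
          induction hypothesis is applied with the two rows exchanged.\<close>
        then have "\<exists>g. elem_word (78 * (m - t)) g \<and> acts_on_rows j i g \<and>
            ((g ** (transv i j k ** M)) $ j $ c = 0 \<or> (g ** (transv i j k ** M)) $ i $ c = 0)"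
          using tm t1 less.prems(1) r new by (intro less.IH) (auto simp: mult.commute)
        then obtain g where g: "elem_word (78 * (m - t)) g" "acts_on_rows i j g"
            "(g ** (transv i j k ** M)) $ i $ c = 0 \<or> (g ** (transv i j k ** M)) $ j $ c = 0"
          using acts_on_rows_sym by blast
        have "78 * (m - t) + 78 * t = 78 * m" using tm by simp
        then have "elem_word (78 * m) (g ** transv i j k)"
          using elem_word_mult[OF g(1) T] by (simp only:)
        moreover have "acts_on_rows i j (g ** transv i j k)"
          by (intro acts_on_rows_mult g acts_on_rows_transv)
        ultimately show ?thesis
          using g(3) unfolding matrix_mul_assoc by blast
      qed
    qed
  qed
  then show thesis using that by blast
qed

text \<open>The Euclidean algorithm does not control which of the two entries vanishes; two more
  letters move the zero to row \<open>j\<close>. The product of the entries is at most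
  \<open>2 ^ (2 * m)\<close>, whence the length.\<close>

lemma clear_entry:
  fixes M :: "int^'n^'n"
  assumes card: "CARD('n) \<ge> 3" and ij: "i \<noteq> j" and M: "entry_bound m M"
  obtains g where "elem_word (158 * (m + 1)) g" "acts_on_rows i j g" "(g ** M) $ j $ c = 0"
proof -
  have prod: "\<bar>M $ i $ c\<bar> * \<bar>M $ j $ c\<bar> < 2 ^ (2 * m + 1)"
  proof -
    have "\<bar>M $ i $ c\<bar> * \<bar>M $ j $ c\<bar> \<le> 2 ^ m * 2 ^ m"
      by (intro mult_mono entry_boundD M) auto
    also have "(2::int) ^ m * 2 ^ m = 2 ^ (2 * m)"
      by (simp only: mult_2 power_add)
    also have "\<dots> < 2 ^ (2 * m + 1)" by simp
    finally show ?thesis .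
  qed
  obtain g where g: "elem_word (78 * (2 * m + 1)) g" "acts_on_rows i j g"
      "(g ** M) $ i $ c = 0 \<or> (g ** M) $ j $ c = 0"
  proof (cases "\<bar>M $ j $ c\<bar> \<le> \<bar>M $ i $ c\<bar>")
    case True
    then show thesis using euclid_rows[OF card ij _ prod] that by blast
  next
    case False
    then have "\<bar>M $ i $ c\<bar> \<le> \<bar>M $ j $ c\<bar>" "\<bar>M $ j $ c\<bar> * \<bar>M $ i $ c\<bar> < 2 ^ (2 * m + 1)"
      using prod by (simp_all add: mult.commute)
    then show thesis
      using euclid_rows[OF card ij[symmetric]] acts_on_rows_sym that by blast
  qed
  show thesis
  proof (cases "(g ** M) $ j $ c = 0")
    case True
    then show thesis
      using that[OF elem_word_mono[OF g(1)]] g by simp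
  next
    case False
    then have zero: "(g ** M) $ i $ c = 0" using g by auto
    \<comment> \<open>Row \<open>j\<close> is added to row \<open>i\<close>, whose entry is 0; then
      the two entries agree and subtraction clears row \<open>j\<close>.\<close>
    let ?h = "transv j i (-1) ** (transv i j 1 ** g)"
    have "elem_word (1 + (1 + 78 * (2 * m + 1))) ?h"
      using ij by (intro elem_word_mult g elem_word_transv) auto
    then have "elem_word (158 * (m + 1)) ?h"
      by (rule elem_word_mono) simp
    moreover have "acts_on_rows i j ?h"
      by (intro acts_on_rows_mult acts_on_rows_transv g)
    moreover have "(?h ** M) $ j $ c = 0"
      using zero ij by (simp add: transv_mult_nth flip: matrix_mul_assoc)
    ultimately show thesis by (rule that)
  qed
qed

section \<open>Inverses of integer matrices\<close>

lemma map_matrix_of_int_mult: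
  "map_matrix of_int (A ** B) = (map_matrix of_int A ** map_matrix of_int B :: real^'n^'n)"
  by (simp add: vec_eq_iff map_matrix_def matrix_matrix_mult_def)

lemma map_matrix_of_int_inject:
  "(map_matrix of_int A :: real^'n^'n) = map_matrix of_int B \<longleftrightarrow> A = B"
  by (simp add: vec_eq_iff map_matrix_def)

lemma int_matrix_inverse:
  fixes M :: "int^'n^'n"
  assumes "det M = 1"
  obtains N where "N ** M = mat 1" "M ** N = mat 1" "det N = 1"
proof -
  have right_inverse: "\<exists>N. M ** N = mat 1" if "det M = 1" for M :: "int^'n^'n"
  proof -
    \<comment> \<open>The adjugate of \<open>M\<close>. By Cramer's rule over the reals, column
      \<open>j\<close> of it solves \<open>M x = e_j\<close> when the determinant is 1, and its
      entries are integers by construction.\<close>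
    define N :: "int^'n^'n" where
      "N = (\<chi> k j. det (\<chi> a b. if b = k then (if a = j then 1 else 0) else M $ a $ b))"
    have dM: "det (map_matrix of_int M :: real^'n^'n) = 1"
      using that by (simp add: det_map_of_int)
    have "map_matrix of_int M *v column j (map_matrix of_int N) = (axis j 1 :: real^'n)" for j
    proof -
      have "real_of_int (N $ k $ j) =
          det (\<chi> a b. if b = k then axis j 1 $ a else (map_matrix of_int M :: real^'n^'n) $ a $ b)" for k
        unfolding N_def vec_lambda_beta det_map_of_int[symmetric]
        by (rule arg_cong[of _ _ det]) (auto simp: vec_eq_iff map_matrix_def axis_def)
      then have "column j (map_matrix of_int N :: real^'n^'n) =
          (\<chi> k. det (\<chi> a b. if b = k then axis j 1 $ a else (map_matrix of_int M :: real^'n^'n) $ a $ b)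
                 / det (map_matrix of_int M :: real^'n^'n))"
        by (simp add: dM column_def vec_eq_iff)
      then show ?thesis
        by (subst cramer) (use dM in auto)
    qed
    then have "map_matrix of_int M ** map_matrix of_int N = (mat 1 :: real^'n^'n)"
      by (auto simp: vec_eq_iff matrix_vector_mult_def matrix_matrix_mult_def column_def mat_def axis_def)
    then have "map_matrix of_int (M ** N) = (map_matrix of_int (mat 1) :: real^'n^'n)"
      by (simp add: map_matrix_of_int_mult) (simp add: map_matrix_def mat_def vec_eq_iff)
    then show ?thesis
      by (auto simp: map_matrix_of_int_inject)
  qed
  \<comment> \<open>\<open>N\<close> has determinant 1 as well, so it has a right inverse, which
    must be \<open>M\<close>; hence \<open>N\<close> is two-sided.\<close>
  obtain N where N: "M ** N = mat 1" using right_inverse assms by blast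
  have dN: "det N = 1"
    using arg_cong[OF N, of det] assms by (simp add: det_mul)
  obtain P where "N ** P = mat 1" using right_inverse dN by blast
  then have "M = P" using matrix_inverse_unique[OF N] by simp
  then show thesis using that N dN \<open>N ** P = mat 1\<close> by simp
qed

text \<open>
  Multiplying by a word of length \<open>c * (m + 1)\<close> only changes the bit length \<open>m\<close> of the entries to
  \<open>m + c * (m + 1)\<close>; hence this relation is transitive.
\<close>

definition log_reduces :: "(int^'n^'n \<Rightarrow> bool) \<Rightarrow> (int^'n^'n \<Rightarrow> bool) \<Rightarrow> bool" where
  "log_reduces P Q \<longleftrightarrow>
     (\<exists>c. \<forall>m M. entry_bound m M \<and> P M \<longrightarrow> (\<exists>g. elem_word (c * (m + 1)) g \<and> Q (g ** M)))"

lemma log_reducesI: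
  assumes "\<And>m M. \<lbrakk>entry_bound m M; P M\<rbrakk> \<Longrightarrow> \<exists>g. elem_word (c * (m + 1)) g \<and> Q (g ** M)"
  shows "log_reduces P Q"
  using assms unfolding log_reduces_def by blast

lemma log_reduces_mono:
  assumes "\<And>M. P M \<Longrightarrow> Q M"
  shows "log_reduces P Q"
  by (rule log_reducesI[where c = 0]) (auto intro!: exI[of _ "mat 1"] elem_word.one assms)

lemma log_reduces_trans [trans]:
  assumes "log_reduces P Q" "log_reduces Q R"
  shows "log_reduces P R"
proof -
  obtain c where c: "\<And>m M. \<lbrakk>entry_bound m M; P M\<rbrakk> \<Longrightarrow> \<exists>g. elem_word (c * (m + 1)) g \<and> Q (g ** M)"
    using assms(1) unfolding log_reduces_def by blast
  obtain c' where c': "\<And>m M. \<lbrakk>entry_bound m M; Q M\<rbrakk> \<Longrightarrow> \<exists>g. elem_word (c' * (m + 1)) g \<and> R (g ** M)"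
    using assms(2) unfolding log_reduces_def by blast
  show ?thesis
  proof (rule log_reducesI[where c = "c' * (1 + c) + c"])
    fix m M assume M: "entry_bound m M" "P M"
    obtain g where g: "elem_word (c * (m + 1)) g" "Q (g ** M)"
      using c[OF M] by blast
    obtain h where h: "elem_word (c' * (m + c * (m + 1) + 1)) h" "R (h ** (g ** M))"
      using c'[OF entry_bound_elem_word[OF g(1) M(1)] g(2)] by blast
    have "c' * (m + c * (m + 1) + 1) + c * (m + 1) = (c' * (1 + c) + c) * (m + 1)"
      by (simp add: algebra_simps)
    then show "\<exists>g. elem_word ((c' * (1 + c) + c) * (m + 1)) g \<and> R (g ** M)"
      using elem_word_mult[OF h(1) g(1)] h(2)
      by (intro exI[of _ "h ** g"]) (simp only: matrix_mul_assoc)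
  qed
qed

section \<open>Gauss-Jordan elimination, one column at a time\<close>

definition unit_columns :: "'n set \<Rightarrow> int^'n^'n \<Rightarrow> bool" where
  "unit_columns D M \<longleftrightarrow> (\<forall>d\<in>D. \<forall>a. M $ a $ d = (if a = d then 1 else 0))"

text \<open>A unit column with index in \<open>D\<close> is zero in every row outside
  \<open>D\<close>, so operations between two such rows leave it alone.\<close>

lemma unit_columns_acts_on_rows:
  assumes "unit_columns D M" "acts_on_rows i j g" "i \<notin> D" "j \<notin> D"
  shows "unit_columns D (g ** M)"
  unfolding unit_columns_def
proof (intro ballI allI)
  fix d a assume d: "d \<in> D"
  have "M $ i $ d = 0" "M $ j $ d = 0"
    using assms d by (auto simp: unit_columns_def)
  then have "(g ** M) $ i $ d = 0" "(g ** M) $ j $ d = 0"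
    using acts_on_rows_zero[OF assms(2)] by blast+
  then show "(g ** M) $ a $ d = (if a = d then 1 else 0)"
    using acts_on_rows_other[OF assms(2), of a M] assms d
    by (cases "a = i \<or> a = j") (auto simp: unit_columns_def)
qed

text \<open>Columns are treated in arbitrary order, so the rows outside \<open>insert i D\<close>
  take the part of those below the pivot. Each is cleared against row \<open>i\<close>, and rows
  already cleared are not touched again.\<close>

lemma log_reduces_clear_below:
  fixes i :: "'n::finite"
  assumes card: "CARD('n) \<ge> 3" and i: "i \<notin> D" and "finite B" "B \<inter> insert i D = {}"
  shows "log_reduces (\<lambda>M::int^'n^'n. det M = 1 \<and> unit_columns D M)
           (\<lambda>M. det M = 1 \<and> unit_columns D M \<and> (\<forall>a\<in>B. M $ a $ i = 0))"
  using assms(3,4)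
proof (induction B rule: finite_induct)
  case empty
  show ?case by (rule log_reduces_mono) simp
next
  case (insert b B)
  have "log_reduces (\<lambda>M::int^'n^'n. det M = 1 \<and> unit_columns D M \<and> (\<forall>a\<in>B. M $ a $ i = 0))
      (\<lambda>M. det M = 1 \<and> unit_columns D M \<and> (\<forall>a\<in>insert b B. M $ a $ i = 0))"
  proof (rule log_reducesI[where c = 158])
    fix m and M :: "int^'n^'n"
    assume M: "entry_bound m M" "det M = 1 \<and> unit_columns D M \<and> (\<forall>a\<in>B. M $ a $ i = 0)"
    have "i \<noteq> b" using insert.prems by auto
    obtain g where g: "elem_word (158 * (m + 1)) g" "acts_on_rows i b g" "(g ** M) $ b $ i = 0"
      using clear_entry[OF card \<open>i \<noteq> b\<close> M(1)] .
    have "(g ** M) $ a $ i = 0" if "a \<in> B" for a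
      using that g(2) M(2) insert.hyps insert.prems by (subst acts_on_rows_other) auto
    then show "\<exists>g. elem_word (158 * (m + 1)) g \<and> det (g ** M) = 1 \<and> unit_columns D (g ** M) \<and>
        (\<forall>a\<in>insert b B. (g ** M) $ a $ i = 0)"
      using g M(2) unit_columns_acts_on_rows[OF _ g(2) i] insert.prems det_elem_word[OF g(1)]
      by (intro exI[of _ g]) (auto simp: det_mul)
  qed
  from log_reduces_trans[OF insert.IH this] show ?case
    using insert.prems by auto
qed

text \<open>Row \<open>i\<close> of the inverse vanishes on \<open>D\<close>, so its entry at \<open>i\<close> is an inverse of the pivot.\<close>

lemma unit_columns_pivot:
  assumes "det M = 1" "unit_columns D M" "i \<notin> D" "\<And>a. a \<notin> insert i D \<Longrightarrow> M $ a $ i = 0"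
  shows "M $ i $ i \<in> {1, -1}"
proof -
  obtain N where N: "N ** M = mat 1" using int_matrix_inverse[OF assms(1)] by blast
  have zero: "N $ i $ d = 0" if "d \<in> D" for d
  proof -
    have "(N ** M) $ i $ d = (\<Sum>a\<in>UNIV. if a = d then N $ i $ d else 0)"
      unfolding matrix_matrix_mult_def vec_lambda_beta
      by (rule sum.cong) (use assms(2) that in \<open>auto simp: unit_columns_def\<close>)
    then show ?thesis using N that assms(3) by (auto simp: mat_def split: if_splits)
  qed
  have "(N ** M) $ i $ i = (\<Sum>a\<in>UNIV. if a = i then N $ i $ i * M $ i $ i else 0)"
    unfolding matrix_matrix_mult_def vec_lambda_beta
    by (rule sum.cong) (use zero assms(4) in auto)
  then have "N $ i $ i * M $ i $ i = 1"
    using N by (simp add: mat_def)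
  then show ?thesis
    by (auto simp: zmult_eq_1_iff)
qed

text \<open>The rows indexed by \<open>D\<close> take the part of those above the pivot. A unit
  pivot divides every entry, so one transvection clears each row, and row \<open>i\<close>, being
  zero in the columns of \<open>D\<close>, does not disturb them.\<close>

lemma log_reduces_clear_above:
  fixes i :: "'n::finite"
  assumes card: "CARD('n) \<ge> 3" and i: "i \<notin> D" and "finite D'" "D' \<subseteq> D"
  shows "log_reduces (\<lambda>M::int^'n^'n. det M = 1 \<and> unit_columns D M \<and> (\<forall>a. a \<notin> insert i D \<longrightarrow> M $ a $ i = 0))
           (\<lambda>M. det M = 1 \<and> unit_columns D M \<and> (\<forall>a. a \<notin> insert i D \<or> a \<in> D' \<longrightarrow> M $ a $ i = 0))"
  using assms(3,4)
proof (induction D' rule: finite_induct)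
  case empty
  show ?case by (rule log_reduces_mono) simp
next
  case (insert d D')
  have "log_reduces
      (\<lambda>M::int^'n^'n. det M = 1 \<and> unit_columns D M \<and> (\<forall>a. a \<notin> insert i D \<or> a \<in> D' \<longrightarrow> M $ a $ i = 0))
      (\<lambda>M. det M = 1 \<and> unit_columns D M \<and> (\<forall>a. a \<notin> insert i D \<or> a \<in> insert d D' \<longrightarrow> M $ a $ i = 0))"
  proof (rule log_reducesI[where c = 26])
    fix m and M :: "int^'n^'n"
    assume M: "entry_bound m M" and
      P: "det M = 1 \<and> unit_columns D M \<and> (\<forall>a. a \<notin> insert i D \<or> a \<in> D' \<longrightarrow> M $ a $ i = 0)"
    have d: "d \<in> D" "d \<noteq> i" using insert.prems i by auto
    have pivot: "M $ i $ i \<in> {1, -1}"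
      using P i by (intro unit_columns_pivot[of M D]) auto
    \<comment> \<open>The pivot is its own inverse, so multiplying by it is dividing by it.\<close>
    define g where "g = transv d i (- (M $ d $ i * M $ i $ i))"
    have "\<bar>- (M $ d $ i * M $ i $ i)\<bar> \<le> 2 ^ m"
      using pivot entry_boundD[OF M, of d i] by (auto simp: abs_mult)
    then have g: "elem_word (26 * (m + 1)) g"
      unfolding g_def by (rule elem_word_transv_log[OF d(2) card])
    have "unit_columns D (g ** M)"
      using P i by (auto simp: g_def unit_columns_def transv_mult_nth)
    moreover have "(g ** M) $ a $ i = 0" if "a \<notin> insert i D \<or> a \<in> insert d D'" for a
      using that pivot P d by (auto simp: g_def transv_mult_nth)
    ultimately show "\<exists>g. elem_word (26 * (m + 1)) g \<and> det (g ** M) = 1 \<and> unit_columns D (g ** M) \<and>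
        (\<forall>a. a \<notin> insert i D \<or> a \<in> insert d D' \<longrightarrow> (g ** M) $ a $ i = 0)"
      using g P det_elem_word[OF g] by (intro exI[of _ g]) (auto simp: det_mul)
  qed
  from log_reduces_trans[OF insert.IH this] show ?case
    using insert.prems by auto
qed

text \<open>Determinant 1 excludes a pivot -1 in the last column; in an earlier column there is a
  further index outside \<open>D\<close>, and the sign can be passed on to its row.\<close>

lemma log_reduces_pivot_sign:
  fixes i :: "'n::finite"
  assumes i: "i \<notin> D"
  shows "log_reduces (\<lambda>M::int^'n^'n. det M = 1 \<and> unit_columns D M \<and> (\<forall>a. a \<noteq> i \<longrightarrow> M $ a $ i = 0))
           (\<lambda>M. det M = 1 \<and> unit_columns (insert i D) M)"
proof (rule log_reducesI[where c = 4])
  fix m and M :: "int^'n^'n"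
  assume M: "entry_bound m M" and
    P: "det M = 1 \<and> unit_columns D M \<and> (\<forall>a. a \<noteq> i \<longrightarrow> M $ a $ i = 0)"
  have pivot: "M $ i $ i \<in> {1, -1}"
    using P i by (intro unit_columns_pivot[of M D]) auto
  show "\<exists>g. elem_word (4 * (m + 1)) g \<and> det (g ** M) = 1 \<and> unit_columns (insert i D) (g ** M)"
  proof (cases "M $ i $ i = 1")
    case True
    then show ?thesis
      using P elem_word_mono[OF elem_word.one]
      by (intro exI[of _ "mat 1"]) (auto simp: unit_columns_def)
  next
    case False
    then have neg: "M $ i $ i = -1" using pivot by auto
    have "insert i D \<noteq> UNIV"
    proof
      assume D: "insert i D = UNIV"
      have entry: "M $ a $ b = (if a = b then (if b = i then -1 else 1) else 0)" for a b
        using P D neg by (cases "b = i") (auto simp: unit_columns_def)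
      have "det M = (\<Prod>b\<in>UNIV. if b = i then -1 else 1)"
        by (subst det_diagonal) (auto simp: entry)
      then show False using P by (simp add: prod.delta)
    qed
    then obtain b where b: "b \<noteq> i" "b \<notin> D" by auto
    \<comment> \<open>In rows \<open>i\<close>, \<open>b\<close> this is the matrix with rows
      \<open>(-1, -2)\<close> and \<open>(0, -1)\<close>: it negates the pivot and keeps the zero in
      row \<open>b\<close>.\<close>
    let ?T = "transv b i 1 ** (transv i b (-1) ** (transv i b (-1) ** transv b i 1)) :: int^'n^'n"
    have T: "elem_word (1 + (1 + (1 + 1))) ?T"
      using b by (intro elem_word_mult elem_word_transv) auto
    have acts: "acts_on_rows i b ?T"
      by (intro acts_on_rows_mult acts_on_rows_transv)
    have "unit_columns D (?T ** M)"
      using P i b by (intro unit_columns_acts_on_rows[OF _ acts]) auto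
    moreover have "(?T ** M) $ a $ i = (if a = i then 1 else 0)" for a
      using b neg P by (auto simp: transv_mult_nth simp flip: matrix_mul_assoc)
    ultimately have "unit_columns (insert i D) (?T ** M)"
      by (auto simp: unit_columns_def)
    moreover have "det (?T ** M) = 1"
      using P det_elem_word[OF T] by (simp add: det_mul)
    moreover have "elem_word (4 * (m + 1)) ?T"
      by (rule elem_word_mono[OF T]) simp
    ultimately show ?thesis by blast
  qed
qed

text \<open>Clearing outside \<open>D\<close> comes first, because only then is the pivot known to
  be 1 or -1, which the two later stages use.\<close>

lemma log_reduces_unit_columns:
  assumes card: "CARD('n::finite) \<ge> 3" and "finite (D :: 'n set)"
  shows "log_reduces (\<lambda>M::int^'n^'n. det M = 1) (\<lambda>M. det M = 1 \<and> unit_columns D M)"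
  using assms(2)
proof (induction D rule: finite_induct)
  case empty
  show ?case by (rule log_reduces_mono) (simp add: unit_columns_def)
next
  case (insert i D)
  note insert.IH
  also have "log_reduces (\<lambda>M::int^'n^'n. det M = 1 \<and> unit_columns D M)
      (\<lambda>M. det M = 1 \<and> unit_columns D M \<and> (\<forall>a\<in>- insert i D. M $ a $ i = 0))"
    using insert.hyps by (intro log_reduces_clear_below[OF card]) auto
  also have "log_reduces \<dots>
      (\<lambda>M::int^'n^'n. det M = 1 \<and> unit_columns D M \<and> (\<forall>a. a \<notin> insert i D \<longrightarrow> M $ a $ i = 0))"
    by (rule log_reduces_mono) auto
  also have "log_reduces \<dots>
      (\<lambda>M. det M = 1 \<and> unit_columns D M \<and> (\<forall>a. a \<notin> insert i D \<or> a \<in> D \<longrightarrow> M $ a $ i = 0))"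
    using insert.hyps by (intro log_reduces_clear_above[OF card]) auto
  also have "log_reduces \<dots>
      (\<lambda>M::int^'n^'n. det M = 1 \<and> unit_columns D M \<and> (\<forall>a. a \<noteq> i \<longrightarrow> M $ a $ i = 0))"
    by (rule log_reduces_mono) auto
  also have "log_reduces \<dots> (\<lambda>M. det M = 1 \<and> unit_columns (insert i D) M)"
    using insert.hyps by (intro log_reduces_pivot_sign) auto
  finally show ?case .
qed

text \<open>A matrix all of whose columns are unit columns is the identity, so the word reducing
  \<open>M\<close> is its inverse.\<close>

lemma elem_word_log_bound:
  assumes "CARD('n) \<ge> 3"
  obtains c where "\<And>m (M::int^'n^'n). \<lbrakk>det M = 1; entry_bound m M\<rbrakk> \<Longrightarrow> elem_word (c * (m + 1)) M"
proof -
  obtain c where c: "\<And>m (M::int^'n^'n). \<lbrakk>entry_bound m M; det M = 1\<rbrakk> \<Longrightarrow>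
      \<exists>g. elem_word (c * (m + 1)) g \<and> det (g ** M) = 1 \<and> unit_columns UNIV (g ** M)"
    using log_reduces_unit_columns[OF assms finite] unfolding log_reduces_def by blast
  have "elem_word (c * (m + 1)) M" if M: "det M = 1" "entry_bound m M" for m and M :: "int^'n^'n"
  proof -
    obtain g where g: "elem_word (c * (m + 1)) g" "unit_columns UNIV (g ** M)"
      using c M by blast
    have "g ** M = mat 1"
      using g(2) by (auto simp: unit_columns_def vec_eq_iff mat_def)
    then show ?thesis by (rule elem_word_right_inverse[OF g(1)])
  qed
  then show thesis using that by blast
qed

subsection \<open>Lengths of curves\<close>

lemma bounded_linear_vector_matrix_mult: "bounded_linear (\<lambda>M. v v* (M :: real^'n^'n))"
  by (rule linear_conv_bounded_linear[THEN iffD1], rule linearI)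
     (simp_all add: vector_matrix_mult_def vec_eq_iff sum.distrib algebra_simps sum_distrib_left)

lemma norm_matrix_vector_mult_le: "norm (A *v x) \<le> norm A * norm (x :: real^'n)" for A :: "real^'n^'m"
proof -
  have "norm (A *v x) = L2_set (\<lambda>i. norm ((A *v x) $ i)) UNIV"
    by (simp add: norm_vec_def)
  also have "\<dots> \<le> L2_set (\<lambda>i. norm (A $ i) * norm x) UNIV"
  proof (rule L2_set_mono)
    fix i
    have "(A *v x) $ i = A $ i \<bullet> x"
      by (simp add: matrix_vector_mult_def inner_vec_def)
    then show "norm ((A *v x) $ i) \<le> norm (A $ i) * norm x"
      by (simp add: Cauchy_Schwarz_ineq2)
  qed simp
  also have "\<dots> = norm A * norm x"
    by (simp add: norm_vec_def L2_set_left_distrib)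
  finally show ?thesis .
qed

lemma norm_transpose_matrix: "norm (transpose A) = norm (A :: real^'n^'m)"
  by (simp add: norm_eq inner_vec_def transpose_def) (rule sum.swap)

lemma norm_symmetric_part_le: "norm ((1/2) *\<^sub>R (A + transpose A)) \<le> norm (A :: real^'n^'n)"
  using norm_triangle_ineq[of A "transpose A"] by (simp add: norm_transpose_matrix)

text \<open>The skew-symmetric part of \<open>A\<close> drops out of the quadratic form; the
  Frobenius norm bounds what remains.\<close>

lemma inner_vector_matrix_mult_le:
  fixes w :: "real^'n" and A :: "real^'n^'n"
  shows "w \<bullet> (w v* A) \<le> norm ((1/2) *\<^sub>R (A + transpose A)) * (w \<bullet> w)"
proof -
  have "w \<bullet> (w v* A) = w \<bullet> (A *v w)"
    by (metis dot_lmul_matrix inner_commute)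
  moreover have "w \<bullet> (transpose A *v w) = w \<bullet> (w v* A)"
    by simp
  ultimately have "w \<bullet> (w v* A) = w \<bullet> (((1/2) *\<^sub>R (A + transpose A)) *v w)"
    by (simp add: matrix_vector_mult_add_rdistrib inner_add_right flip: scaleR_matrix_vector_assoc)
  also have "\<dots> \<le> norm w * norm (((1/2) *\<^sub>R (A + transpose A)) *v w)"
    by (rule norm_cauchy_schwarz)
  also have "\<dots> \<le> norm w * (norm ((1/2) *\<^sub>R (A + transpose A)) * norm w)"
    by (intro mult_left_mono norm_matrix_vector_mult_le) simp
  finally show ?thesis
    by (simp add: power2_norm_eq_inner[symmetric] power2_eq_square algebra_simps)
qed

text \<open>
  With \<open>w t = v v* c t\<close>, the derivative of \<open>ln (w t \<bullet> w t)\<close> is at most twice the speed, because only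
  the symmetric part of \<open>(c t)\<^sup>-\<^sup>1 c' t\<close> contributes to \<open>w \<bullet> w'\<close>.
\<close>

lemma curve_vector_growth:
  fixes c :: "real \<Rightarrow> real^'n^'n" and v :: "real^'n"
  assumes c: "valid_path c" "path_image c \<subseteq> carrier SL_R"
    and int: "sym_space_speed c integrable_on {0..1}"
  shows "norm (v v* pathfinish c) \<le> exp (integral {0..1} (sym_space_speed c)) * norm (v v* pathstart c)"
proof (cases "v = 0")
  case True
  then show ?thesis by simp
next
  case False
  have SL: "c t \<in> carrier SL_R" if "t \<in> {0..1}" for t
    using c(2) that by (auto simp: path_image_def)
  define w where "w t = v v* c t" for t
  have w0: "w t \<noteq> 0" if "t \<in> {0..1}" for t
  proof
    assume "w t = 0"
    then have "(v v* c t) v* matrix_inv (c t) = 0" by (simp add: w_def)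
    then show False
      using False matrix_inv_SL(3)[OF SL[OF that]] by (simp add: vector_matrix_mul_assoc)
  qed
  define \<phi> where "\<phi> t = ln (w t \<bullet> w t)" for t
  obtain F where F: "finite F" "c C1_differentiable_on ({0..1} - F)" and cont: "continuous_on {0..1} c"
    using c(1) by (auto simp: valid_path_def piecewise_C1_differentiable_on_def)
  have contw: "continuous_on {0..1} w"
    unfolding w_def by (intro bounded_linear.continuous_on[OF bounded_linear_vector_matrix_mult] cont)
  have cont\<phi>: "continuous_on {0..1} \<phi>"
    unfolding \<phi>_def by (intro continuous_intros contw) (use w0 in auto)
  define D where "D t = 2 * (w t \<bullet> (v v* vector_derivative c (at t))) / (w t \<bullet> w t)" for t
  have deriv: "(\<phi> has_vector_derivative D t) (at t)" if t: "t \<in> {0<..<1} - F" for t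
  proof -
    have "(c has_vector_derivative vector_derivative c (at t)) (at t)"
      using t F(2) by (auto simp: C1_differentiable_on_eq vector_derivative_works[symmetric])
    then have "(w has_vector_derivative (v v* vector_derivative c (at t))) (at t)"
      unfolding w_def by (rule bounded_linear.has_vector_derivative[OF bounded_linear_vector_matrix_mult])
    then have dw: "(w has_derivative (\<lambda>h. h *\<^sub>R (v v* vector_derivative c (at t)))) (at t)"
      by (simp add: has_vector_derivative_def)
    have "w t \<bullet> w t > 0" using w0[of t] t by simp
    then have "((\<lambda>t. ln (w t \<bullet> w t)) has_derivative (\<lambda>h. h * D t)) (at t)"
      by (auto intro!: derivative_eq_intros dw simp: D_def fun_eq_iff inner_commute field_simps)
    then show ?thesis
      by (simp add: has_vector_derivative_def \<phi>_def[abs_def])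
  qed
  have "(D has_integral (\<phi> 1 - \<phi> 0)) {0..1}"
    by (rule fundamental_theorem_of_calculus_interior_strong[OF F(1) _ deriv cont\<phi>]) simp_all
  then have D1: "((\<lambda>t. if t \<in> insert 0 (insert 1 F) then 0 else D t) has_integral (\<phi> 1 - \<phi> 0)) {0..1}"
    by (rule has_integral_spike_finite[rotated 2, where S = "insert 0 (insert 1 F)"]) (use F(1) in auto)
  have D2: "((\<lambda>t. 2 * sym_space_speed c t) has_integral 2 * integral {0..1} (sym_space_speed c)) {0..1}"
    by (intro has_integral_mult_right integrable_integral int)
  have "\<phi> 1 - \<phi> 0 \<le> 2 * integral {0..1} (sym_space_speed c)"
  proof (rule has_integral_le[OF D1 D2])
    fix t :: real assume t: "t \<in> {0..1}"
    show "(if t \<in> insert 0 (insert 1 F) then 0 else D t) \<le> 2 * sym_space_speed c t"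
    proof (cases "t \<in> insert 0 (insert 1 F)")
      case True
      then show ?thesis by (simp add: sym_space_speed_def Let_def)
    next
      case False
      define A where "A = matrix_inv (c t) ** vector_derivative c (at t)"
      have "c t ** A = vector_derivative c (at t)"
        by (simp add: A_def matrix_mul_assoc matrix_inv_SL(3)[OF SL[OF t]])
      then have "v v* vector_derivative c (at t) = w t v* A"
        by (metis w_def vector_matrix_mul_assoc)
      then have "w t \<bullet> (v v* vector_derivative c (at t)) \<le> sym_space_speed c t * (w t \<bullet> w t)"
        using inner_vector_matrix_mult_le[of "w t" A] by (simp add: sym_space_speed_def Let_def A_def)
      moreover have "w t \<bullet> w t > 0" using w0[OF t] by simp
      ultimately have "D t \<le> 2 * sym_space_speed c t"
        by (simp add: D_def divide_le_eq)
      then show ?thesis using False by simp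
    qed
  qed
  moreover have "\<phi> t = 2 * ln (norm (w t))" if "t \<in> {0..1}" for t
    using w0[OF that] by (simp add: \<phi>_def dot_square_norm ln_realpow)
  ultimately have "ln (norm (w 1)) \<le> integral {0..1} (sym_space_speed c) + ln (norm (w 0))"
    by simp
  then have "exp (ln (norm (w 1))) \<le> exp (integral {0..1} (sym_space_speed c) + ln (norm (w 0)))"
    by simp
  then show ?thesis
    using w0[of 0] w0[of 1] by (simp add: exp_add w_def pathfinish_def pathstart_def)
qed

text \<open>Consequently \<open>norm (v v* g)\<close> depends only on the coset of
  \<open>g\<close>.\<close>

lemma norm_vector_SO_mult:
  assumes "k \<in> SO_R"
  shows "norm (x v* k) = norm (x :: real^'n)"
proof -
  have "k ** transpose k = mat 1"
    using assms by (simp add: SO_R_def rotation_matrix_def orthogonal_matrix_def)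
  then have "k *v (transpose k *v x) = x"
    by (simp only: matrix_vector_mul_assoc matrix_vector_mul_lid)
  then have "(x v* k) \<bullet> (x v* k) = x \<bullet> x"
    by (simp only: dot_lmul_matrix transpose_matrix_vector)
  then show ?thesis by (simp add: norm_eq)
qed

text \<open>Apply \<open>curve_vector_growth\<close> to the basis vector \<open>v\<close> of index
  \<open>a\<close>: \<open>v v* (\<gamma> g)\<close> is row \<open>a\<close> of
  \<open>\<gamma> g\<close>. The constant pays for passing between \<open>\<gamma> g\<close> and
  \<open>\<gamma>\<close>; it is kept at least 1 so that its logarithm is nonnegative.\<close>

lemma curve_length_entry_bound:
  fixes g :: "real^'n^'n"
  assumes g: "g \<in> carrier SL_R"
  obtains C where "C \<ge> 1"
    "\<And>\<gamma> L a b. L \<in> sym_space_curve_lengths (g <#\<^bsub>SL_R\<^esub> SO_R) (sym_space_act \<gamma> (g <#\<^bsub>SL_R\<^esub> SO_R)) \<Longrightarrow>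
       real_of_int \<bar>\<gamma> $ a $ b\<bar> \<le> C * exp L"
proof -
  define C where "C = max 1 (norm g * norm (matrix_inv g))"
  have "real_of_int \<bar>\<gamma> $ a $ b\<bar> \<le> C * exp L"
    if L: "L \<in> sym_space_curve_lengths (g <#\<^bsub>SL_R\<^esub> SO_R) (sym_space_act \<gamma> (g <#\<^bsub>SL_R\<^esub> SO_R))" for \<gamma> L a b
  proof -
    let ?\<gamma> = "map_matrix of_int \<gamma> :: real^'n^'n"
    obtain c where c: "valid_path c" "path_image c \<subseteq> carrier SL_R" "sym_space_speed c integrable_on {0..1}"
      and Lc: "L = integral {0..1} (sym_space_speed c)"
      and ends: "pathstart c \<in> g <#\<^bsub>SL_R\<^esub> SO_R" "pathfinish c \<in> ?\<gamma> <#\<^bsub>SL_R\<^esub> (g <#\<^bsub>SL_R\<^esub> SO_R)"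
      using L by (auto simp: sym_space_curve_lengths_def sym_space_act_def)
    obtain k l where k: "k \<in> SO_R" "pathstart c = g ** k" and l: "l \<in> SO_R" "pathfinish c = ?\<gamma> ** (g ** l)"
      using ends by (auto simp: l_coset_def SL_group_def)
    define v :: "real^'n" where "v = axis a 1"
    have "norm (v v* (?\<gamma> ** g)) = norm (v v* pathfinish c)"
      using norm_vector_SO_mult[OF l(1), of "v v* (?\<gamma> ** g)"]
      by (simp add: l(2) vector_matrix_mul_assoc matrix_mul_assoc)
    also have "\<dots> \<le> exp L * norm (v v* pathstart c)"
      unfolding Lc by (rule curve_vector_growth[OF c])
    also have "norm (v v* pathstart c) = norm (v v* g)"
      using norm_vector_SO_mult[OF k(1), of "v v* g"] by (simp add: k(2) vector_matrix_mul_assoc)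
    also have "norm (v v* g) \<le> norm g"
      using norm_matrix_vector_mult_le[of "transpose g" v] by (simp add: norm_transpose_matrix v_def)
    finally have 1: "norm (v v* (?\<gamma> ** g)) \<le> exp L * norm g" by simp
    have "v v* ?\<gamma> = (v v* (?\<gamma> ** g)) v* matrix_inv g"
      using matrix_inv_SL(3)[OF g] by (simp add: vector_matrix_mul_assoc flip: matrix_mul_assoc)
    then have "norm (v v* ?\<gamma>) \<le> norm (matrix_inv g) * norm (v v* (?\<gamma> ** g))"
      using norm_matrix_vector_mult_le[of "transpose (matrix_inv g)" "v v* (?\<gamma> ** g)"]
      by (simp add: norm_transpose_matrix)
    also have "\<dots> \<le> norm (matrix_inv g) * (exp L * norm g)"
      by (intro mult_left_mono 1) simp
    also have "\<dots> \<le> C * exp L"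
      by (simp add: C_def mult.commute mult.left_commute mult_right_mono)
    finally have "norm (v v* ?\<gamma>) \<le> C * exp L" .
    moreover have "(v v* ?\<gamma>) $ b = real_of_int (\<gamma> $ a $ b)"
      by (simp add: v_def vector_matrix_mult_def axis_def if_distrib if_distribR cong: if_cong)
    ultimately show ?thesis
      using component_le_norm_cart[of "v v* ?\<gamma>" b] by simp
  qed
  then show thesis using that[of C] by (simp add: C_def)
qed

section \<open>Short curves along words in elementary matrices\<close>

lemma map_matrix_of_int_transv: "(map_matrix of_int (transv i j k) :: real^'n^'n) = transv i j (of_int k)"
  by (simp add: vec_eq_iff transv_def)

lemma transv_in_SL: "i \<noteq> j \<Longrightarrow> transv i j k \<in> carrier SL_group"
  by (simp add: SL_group_def det_transv)

text \<open>The curve is the orbit of \<open>g\<close> under a one-parameter group of transvections.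
  Its left logarithmic derivative is the constant \<open>matrix_inv g ** E ** g\<close>, so its
  speed is constant.\<close>

lemma transv_curve_length:
  fixes g :: "real^'n^'n"
  assumes g: "g \<in> carrier SL_R" and "i \<noteq> j"
  shows "\<exists>L\<in>sym_space_curve_lengths {g} {transv i j k ** g}.
           L \<le> norm (matrix_inv g ** ((transv i j k - mat 1) ** g))"
proof -
  define E :: "real^'n^'n" where "E = transv i j k - mat 1"
  define B where "B = matrix_inv g ** (E ** g)"
  define c where "c t = g + t *\<^sub>R (E ** g)" for t :: real
  have transv: "transv i j (t * k) = mat 1 + t *\<^sub>R E" for t
    by (simp add: E_def vec_eq_iff transv_def mat_def)
  have c: "c t = transv i j (t * k) ** g" for t
  proof -
    have "(mat 1 + t *\<^sub>R E) ** g = mat 1 ** g + t *\<^sub>R (E ** g)"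
      by (simp add: vec_eq_iff matrix_matrix_mult_def sum.distrib distrib_right sum_distrib_left mult.assoc)
    then show ?thesis by (simp add: c_def transv)
  qed
  have cSL: "c t \<in> carrier SL_R" for t
    using g assms(2) by (simp add: c SL_group_def det_mul det_transv)
  have inv: "matrix_inv (c t) = matrix_inv g ** transv i j (- (t * k))" for t
  proof (rule matrix_inverse_unique[OF matrix_inv_SL(2)[OF cSL]])
    have "c t ** (matrix_inv g ** transv i j (- (t * k))) =
        transv i j (t * k) ** (g ** matrix_inv g) ** transv i j (- (t * k))"
      by (simp only: c matrix_mul_assoc)
    then show "c t ** (matrix_inv g ** transv i j (- (t * k))) = mat 1"
      using assms(2) by (simp add: matrix_inv_SL(3)[OF g] transv_add)
  qed
  \<comment> \<open>Row \<open>j\<close> of \<open>E\<close> vanishes, so adding a multiple of it to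
    row \<open>i\<close> changes nothing.\<close>
  have E: "transv i j s ** E = E" for s
    using assms(2) by (auto simp: vec_eq_iff transv_mult_nth) (auto simp: E_def transv_def mat_def)
  have dc: "(c has_vector_derivative (E ** g)) (at t)" for t
    unfolding c_def by (auto intro!: derivative_eq_intros)
  have speed: "sym_space_speed c t = norm ((1/2) *\<^sub>R (B + transpose B))" for t
  proof -
    have "matrix_inv (c t) ** (E ** g) = matrix_inv g ** (transv i j (- (t * k)) ** E) ** g"
      by (simp only: inv matrix_mul_assoc)
    then have "matrix_inv (c t) ** vector_derivative c (at t) = B"
      by (simp add: vector_derivative_at[OF dc] E B_def matrix_mul_assoc)
    then show ?thesis by (simp add: sym_space_speed_def Let_def)
  qed
  have "c C1_differentiable_on {0..1}"
    unfolding C1_differentiable_on_def using dc by (intro exI[of _ "\<lambda>_. E ** g"]) auto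
  then have "valid_path c"
    by (simp add: valid_path_def C1_differentiable_imp_piecewise)
  moreover have "path_image c \<subseteq> carrier SL_R"
    using cSL by (auto simp: path_image_def)
  moreover have "pathstart c = g" "pathfinish c = transv i j k ** g"
    by (simp add: pathstart_def c_def) (simp add: pathfinish_def c)
  moreover have "sym_space_speed c integrable_on {0..1}"
    unfolding speed[abs_def] by (rule integrable_const_ivl)
  ultimately have "integral {0..1} (sym_space_speed c) \<in> sym_space_curve_lengths {g} {transv i j k ** g}"
    by (auto simp: sym_space_curve_lengths_def)
  moreover have "integral {0..1} (sym_space_speed c) \<le> norm B"
  proof -
    have "integral {0..1} (sym_space_speed c) = norm ((1/2) *\<^sub>R (B + transpose B))"
      by (simp add: speed[abs_def])
    then show ?thesis by (simp only: norm_symmetric_part_le)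
  qed
  ultimately show ?thesis
    unfolding B_def E_def by blast
qed

text \<open>Chain rule for either half of a concatenated path, with \<open>s\<close> equal to 0 or
  -1. The open set \<open>U\<close> keeps away from the midpoint, where the two halves meet.\<close>

lemma sym_space_speed_transform:
  assumes "(c has_vector_derivative D) (at (2 * t + s))" "open U" "t \<in> U"
    and "\<And>u. u \<in> U \<Longrightarrow> c (2 * u + s) = d u"
  shows "sym_space_speed d t = 2 * sym_space_speed c (2 * t + s)"
proof -
  have "((\<lambda>u. 2 * u + s) has_vector_derivative 2) (at t)"
    by (auto intro!: derivative_eq_intros)
  then have "((\<lambda>u. c (2 * u + s)) has_vector_derivative 2 *\<^sub>R D) (at t)"
    using assms(1) by (intro vector_diff_chain_at[simplified o_def])
  then have "(d has_vector_derivative 2 *\<^sub>R D) (at t)"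
    by (rule has_vector_derivative_transform_within_open[OF _ assms(2-4)])
  then have d: "vector_derivative d (at t) = 2 *\<^sub>R D"
    by (rule vector_derivative_at)
  define A where "A = matrix_inv (c (2 * t + s)) ** D"
  have "matrix_inv (d t) ** vector_derivative d (at t) = 2 *\<^sub>R A"
    using assms(4)[OF assms(3)] by (simp add: d A_def matrix_scalar_ac flip: scalar_matrix_assoc)
  moreover have "transpose (2 *\<^sub>R A) = 2 *\<^sub>R transpose A"
    by (simp add: transpose_def vec_eq_iff)
  ultimately show ?thesis
    using vector_derivative_at[OF assms(1)]
    by (simp add: sym_space_speed_def Let_def A_def flip: scaleR_add_right)
qed

text \<open>The middle endpoint is a single matrix and not a coset, since concatenation takes place
  in the group and must be continuous there.\<close>

lemma sym_space_curve_lengths_join: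
  assumes "L1 \<in> sym_space_curve_lengths p {b}" "L2 \<in> sym_space_curve_lengths {b} q"
  shows "L1 + L2 \<in> sym_space_curve_lengths p q"
proof -
  obtain c1 where c1: "valid_path c1" "path_image c1 \<subseteq> carrier SL_R" "pathstart c1 \<in> p" "pathfinish c1 = b"
      "(sym_space_speed c1 has_integral L1) {0..1}"
    using assms(1) by (auto simp: sym_space_curve_lengths_def intro: integrable_integral)
  obtain c2 where c2: "valid_path c2" "path_image c2 \<subseteq> carrier SL_R" "pathstart c2 = b" "pathfinish c2 \<in> q"
      "(sym_space_speed c2 has_integral L2) {0..1}"
    using assms(2) by (auto simp: sym_space_curve_lengths_def intro: integrable_integral)
  obtain F1 where F1: "finite F1" "\<forall>x\<in>{0..1} - F1. c1 differentiable at x"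
    using c1(1) by (auto simp: valid_path_def piecewise_C1_differentiable_on_def C1_differentiable_on_eq)
  obtain F2 where F2: "finite F2" "\<forall>x\<in>{0..1} - F2. c2 differentiable at x"
    using c2(1) by (auto simp: valid_path_def piecewise_C1_differentiable_on_def C1_differentiable_on_eq)
  let ?c = "c1 +++ c2"
  have i1: "((\<lambda>x. 2 * sym_space_speed c1 (2 * x)) has_integral L1) {0..1/2}"
   and i2: "((\<lambda>x. 2 * sym_space_speed c2 (2 * x - 1)) has_integral L2) {1/2..1}"
    using has_integral_affinity01[OF c1(5), where m = 2 and c = 0, THEN has_integral_cmul[where c = 2]]
          has_integral_affinity01[OF c2(5), where m = 2 and c = "-1", THEN has_integral_cmul[where c = 2]]
    by (simp_all only: image_affinity_atLeastAtMost_div_diff, simp_all)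
  have j1: "(sym_space_speed ?c has_integral L1) {0..1/2}"
  proof (rule has_integral_spike_finite[OF _ _ i1])
    show "finite (insert (1/2) ((\<lambda>x. x / 2) ` F1))" using F1(1) by simp
    fix t :: real assume "t \<in> {0..1/2} - insert (1/2) ((\<lambda>x. x / 2) ` F1)"
    then have t: "0 \<le> t" "t < 1/2" "2 * t \<notin> F1"
      using image_eqI[of t "\<lambda>x. x / 2" "2 * t" F1] by auto
    have "sym_space_speed ?c t = 2 * sym_space_speed c1 (2 * t + 0)"
    proof (rule sym_space_speed_transform)
      show "(c1 has_vector_derivative vector_derivative c1 (at (2 * t + 0))) (at (2 * t + 0))"
        using F1(2) t by (simp flip: vector_derivative_works)
      show "open {..<1/2::real}" by simp
    qed (use t in \<open>auto simp: joinpaths_def\<close>)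
    then show "sym_space_speed ?c t = 2 * sym_space_speed c1 (2 * t)" by simp
  qed
  have j2: "(sym_space_speed ?c has_integral L2) {1/2..1}"
  proof (rule has_integral_spike_finite[OF _ _ i2])
    show "finite (insert (1/2) ((\<lambda>x. (x + 1) / 2) ` F2))" using F2(1) by simp
    fix t :: real assume "t \<in> {1/2..1} - insert (1/2) ((\<lambda>x. (x + 1) / 2) ` F2)"
    then have t: "1/2 < t" "t \<le> 1" "2 * t - 1 \<notin> F2"
      using image_eqI[of t "\<lambda>x. (x + 1) / 2" "2 * t - 1" F2] by auto
    have "sym_space_speed ?c t = 2 * sym_space_speed c2 (2 * t + (- 1))"
    proof (rule sym_space_speed_transform)
      show "(c2 has_vector_derivative vector_derivative c2 (at (2 * t + (- 1)))) (at (2 * t + (- 1)))"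
        using F2(2) t by (simp flip: vector_derivative_works)
      show "open {1/2::real<..}" by simp
    qed (use t in \<open>auto simp: joinpaths_def\<close>)
    then show "sym_space_speed ?c t = 2 * sym_space_speed c2 (2 * t - 1)" by simp
  qed
  have "(sym_space_speed ?c has_integral (L1 + L2)) {0..1}"
    by (rule has_integral_combine[OF _ _ j1 j2]) auto
  moreover have "valid_path ?c"
    using c1 c2 by (intro valid_path_join) auto
  moreover have "path_image ?c \<subseteq> carrier SL_R"
    using c1 c2 by (simp add: path_image_join)
  ultimately show ?thesis
    using c1 c2 by (auto simp: sym_space_curve_lengths_def has_integral_integrable
        intro!: exI[of _ ?c] dest: integral_unique)
qed

lemma sym_space_curve_lengths_refl:
  assumes "g \<in> carrier SL_R"
  shows "0 \<in> sym_space_curve_lengths {g} {g}"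
proof -
  have speed: "sym_space_speed (\<lambda>_. g) t = 0" for t
    by (simp add: sym_space_speed_def Let_def transpose_def vec_eq_iff)
  have "valid_path (\<lambda>_::real. g)"
    by (simp add: valid_path_def C1_differentiable_imp_piecewise)
  then show ?thesis
    using assms unfolding sym_space_curve_lengths_def
    by (auto simp: speed[abs_def] path_image_def pathstart_def pathfinish_def intro!: exI[of _ "\<lambda>_. g"])
qed

lemma sym_space_curve_lengths_mono:
  "\<lbrakk>p \<subseteq> p'; q \<subseteq> q'\<rbrakk> \<Longrightarrow> sym_space_curve_lengths p q \<subseteq> sym_space_curve_lengths p' q'"
  unfolding sym_space_curve_lengths_def by blast

lemma sym_space_curve_lengths_nonneg: "L \<in> sym_space_curve_lengths p q \<Longrightarrow> 0 \<le> L"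
  by (auto simp: sym_space_curve_lengths_def sym_space_speed_def Let_def intro!: integral_nonneg)

text \<open>
  Fixing the representatives \<open>g\<close> and \<open>\<gamma> g\<close> as endpoints lets curves be concatenated in \<open>SL(n,\<real>)\<close>.
\<close>

lemma elem_word_curve_length:
  fixes g :: "real^'n^'n"
  assumes g: "g \<in> carrier SL_R"
  obtains K where "K \<ge> 0"
    "\<And>N \<gamma>. elem_word N \<gamma> \<Longrightarrow>
       \<exists>L\<in>sym_space_curve_lengths {g} {map_matrix of_int \<gamma> ** g}. L \<le> K * real N"
proof -
  \<comment> \<open>A sum over the finitely many letters bounds each of its nonnegative
    terms.\<close>
  define K where "K = (\<Sum>i\<in>(UNIV::'n set). \<Sum>j\<in>(UNIV::'n set). \<Sum>k\<in>{1, -1::real}.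
      norm (matrix_inv g ** ((transv i j k - mat 1) ** g)))"
  have K: "norm (matrix_inv g ** ((transv i j k - mat 1) ** g)) \<le> K" if "k \<in> {1, -1}" for i j k
  proof -
    have "norm (matrix_inv g ** ((transv i j k - mat 1) ** g)) \<le>
        (\<Sum>k\<in>{1, -1::real}. norm (matrix_inv g ** ((transv i j k - mat 1) ** g)))"
      by (rule member_le_sum) (use that in auto)
    also have "\<dots> \<le> (\<Sum>j\<in>(UNIV::'n set). \<Sum>k\<in>{1, -1::real}. norm (matrix_inv g ** ((transv i j k - mat 1) ** g)))"
      by (rule member_le_sum[of j UNIV "\<lambda>j. \<Sum>k\<in>{1, -1::real}. norm (matrix_inv g ** ((transv i j k - mat 1) ** g))"])
         (auto intro!: sum_nonneg)
    also have "\<dots> \<le> K"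
      unfolding K_def
      by (rule member_le_sum[of i UNIV "\<lambda>i. \<Sum>j\<in>(UNIV::'n set). \<Sum>k\<in>{1, -1::real}. norm (matrix_inv g ** ((transv i j k - mat 1) ** g))"])
         (auto intro!: sum_nonneg)
    finally show ?thesis .
  qed
  have "K \<ge> 0" unfolding K_def by (intro sum_nonneg) auto
  have "\<exists>L\<in>sym_space_curve_lengths {g} {map_matrix of_int \<gamma> ** g}. L \<le> K * real N"
    if "elem_word N \<gamma>" for N \<gamma>
    using that
  proof induction
    case one
    have "map_matrix of_int (mat 1 :: int^'n^'n) = (mat 1 :: real^'n^'n)"
      by (simp add: vec_eq_iff mat_def)
    then show ?case
      using sym_space_curve_lengths_refl[OF g] by auto
  next
    case (weaken N \<gamma>)
    have "K * real N \<le> K * real (Suc N)"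
      using \<open>K \<ge> 0\<close> by (intro mult_left_mono) auto
    then show ?case using weaken.IH by (meson order_trans)
  next
    case (mult N \<gamma> i j k)
    let ?T = "transv i j (of_int k) :: real^'n^'n"
    obtain L where L: "L \<in> sym_space_curve_lengths {g} {map_matrix of_int \<gamma> ** g}" "L \<le> K * real N"
      using mult.IH by blast
    have T: "?T \<in> carrier SL_R" using mult.hyps by (intro transv_in_SL)
    have "?T <#\<^bsub>SL_R\<^esub> {x} = {?T ** x}" for x
      by (simp add: l_coset_def SL_group_def)
    \<comment> \<open>A curve from \<open>g\<close> to \<open>\<gamma> g\<close> is translated by
      the new first letter without change of length; it is then preceded by the curve from
      \<open>g\<close> to \<open>?T ** g\<close>.\<close>
    then have "L \<in> sym_space_curve_lengths {?T ** g} {?T ** (map_matrix of_int \<gamma> ** g)}"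
      using subsetD[OF sym_space_curve_lengths_mult_left[OF T] L(1)] by simp
    then have L': "L \<in> sym_space_curve_lengths {?T ** g} {map_matrix of_int (transv i j k ** \<gamma>) ** g}"
      by (simp add: map_matrix_of_int_mult map_matrix_of_int_transv matrix_mul_assoc)
    obtain L0 where L0: "L0 \<in> sym_space_curve_lengths {g} {?T ** g}" "L0 \<le> K"
      using transv_curve_length[OF g \<open>i \<noteq> j\<close>, of "of_int k"] K[of "of_int k" i j] mult.hyps
      by (auto intro: order_trans)
    have "L0 + L \<le> K * real (Suc N)"
      using L(2) L0(2) by (simp add: algebra_simps)
    then show ?case
      using sym_space_curve_lengths_join[OF L0(1) L'] by blast
  qed
  then show thesis using that \<open>K \<ge> 0\<close> by blast
qed

subsection \<open>Word length\<close>

context group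
begin

lemma foldr_mult_append:
  assumes "set xs \<subseteq> carrier G" "set ys \<subseteq> carrier G"
  shows "foldr (\<otimes>) (xs @ ys) \<one> = foldr (\<otimes>) xs \<one> \<otimes> foldr (\<otimes>) ys \<one>"
proof -
  have closed: "foldr (\<otimes>) zs \<one> \<in> carrier G" if "set zs \<subseteq> carrier G" for zs
    using that by (induction zs) auto
  show ?thesis
    using assms(1) by (induction xs) (use assms(2) closed in \<open>auto simp: m_assoc\<close>)
qed

lemma generate_word:
  assumes "S \<subseteq> carrier G" "x \<in> generate G S"
  obtains ws where "set ws \<subseteq> S \<union> m_inv G ` S" "foldr (\<otimes>) ws \<one> = x"
proof -
  have sub: "S \<union> m_inv G ` S \<subseteq> carrier G" using assms(1) by auto
  have "\<exists>ws. set ws \<subseteq> S \<union> m_inv G ` S \<and> foldr (\<otimes>) ws \<one> = x"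
    using assms(2)
  proof induction
    case one
    show ?case by (rule exI[of _ "[]"]) simp
  next
    case (incl h)
    then show ?case using assms(1) by (intro exI[of _ "[h]"]) auto
  next
    case (inv h)
    then show ?case using assms(1) by (intro exI[of _ "[inv h]"]) auto
  next
    case (eng h1 h2)
    then obtain us vs where
      "set us \<subseteq> S \<union> m_inv G ` S" "foldr (\<otimes>) us \<one> = h1"
      "set vs \<subseteq> S \<union> m_inv G ` S" "foldr (\<otimes>) vs \<one> = h2"
      by blast
    then show ?case
      using foldr_mult_append[of us vs] sub by (intro exI[of _ "us @ vs"]) auto
  qed
  then show thesis using that by blast
qed

lemma word_length_le:
  assumes "set ws \<subseteq> S \<union> m_inv G ` S" "foldr (\<otimes>) ws \<one> = x"
  shows "word_length G S x \<le> length ws"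
  unfolding word_length_def by (rule Least_le) (use assms in blast)

text \<open>Generation makes the set under \<open>LEAST\<close> nonempty, so the minimum is attained
  by an actual word.\<close>

lemma word_length_word:
  assumes "S \<subseteq> carrier G" "generate G S = carrier G" "x \<in> carrier G"
  obtains ws where "length ws = word_length G S x" "set ws \<subseteq> S \<union> m_inv G ` S" "foldr (\<otimes>) ws \<one> = x"
proof -
  have "\<exists>k ws. length ws = k \<and> set ws \<subseteq> S \<union> m_inv G ` S \<and> foldr (\<otimes>) ws \<one> = x"
    using generate_word assms by metis
  from LeastI_ex[OF this] show thesis
    using that unfolding word_length_def by blast
qed

lemma word_length_one: "word_length G S \<one> = 0"
  using word_length_le[of "[]" S \<one>] by simp

lemma word_length_mult_le:
  assumes "S \<subseteq> carrier G" "generate G S = carrier G" "x \<in> carrier G" "y \<in> carrier G"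
  shows "word_length G S (x \<otimes> y) \<le> word_length G S x + word_length G S y"
proof -
  obtain us where us: "length us = word_length G S x" "set us \<subseteq> S \<union> m_inv G ` S" "foldr (\<otimes>) us \<one> = x"
    using word_length_word assms by metis
  obtain vs where vs: "length vs = word_length G S y" "set vs \<subseteq> S \<union> m_inv G ` S" "foldr (\<otimes>) vs \<one> = y"
    using word_length_word assms by metis
  have "S \<union> m_inv G ` S \<subseteq> carrier G" using assms(1) by auto
  then have "foldr (\<otimes>) (us @ vs) \<one> = x \<otimes> y"
    using us vs by (subst foldr_mult_append) auto
  then show ?thesis
    using word_length_le[of "us @ vs" S "x \<otimes> y"] us vs by simp
qed

end

lemma group_SL_Z: "group (SL_Z :: (int^'n^'n) monoid)"
proof (rule groupI)
  fix g :: "int^'n^'n" assume "g \<in> carrier SL_Z"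
  then obtain h where "h ** g = mat 1" "det h = 1"
    using int_matrix_inverse[of g] by (auto simp: SL_group_def)
  then show "\<exists>h\<in>carrier SL_Z. h \<otimes>\<^bsub>SL_Z\<^esub> g = \<one>\<^bsub>SL_Z\<^esub>"
    by (intro bexI[of _ h]) (auto simp: SL_group_def)
qed (auto simp: SL_group_def det_mul matrix_mul_assoc)

lemma SL_group_simps:
  "x \<in> carrier SL_group \<longleftrightarrow> det x = 1" "mult SL_group = (**)" "\<one>\<^bsub>SL_group\<^esub> = mat 1"
  by (simp_all add: SL_group_def)

subsection \<open>Orbit maps\<close>

lemma elem_word_word_length:
  fixes S :: "(int^'n^'n) set"
  assumes S: "S \<subseteq> carrier SL_Z" "generate SL_Z S = carrier SL_Z"
  obtains K where "\<And>N \<gamma>. elem_word N \<gamma> \<Longrightarrow> word_length SL_Z S \<gamma> \<le> K * N"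
proof -
  interpret group "SL_Z :: (int^'n^'n) monoid" by (rule group_SL_Z)
  \<comment> \<open>The triples with \<open>i = j\<close> are not letters; they can only enlarge
    \<open>Max X\<close>.\<close>
  define X where "X = (\<lambda>(i, j, k). word_length SL_Z S (transv i j k)) ` (UNIV \<times> UNIV \<times> {1, -1})"
  have "finite X" by (simp add: X_def)
  have K: "word_length SL_Z S (transv i j k) \<le> Max X" if "k \<in> {1, -1}" for i j k
    by (rule Max_ge[OF \<open>finite X\<close>]) (use that in \<open>force simp: X_def\<close>)
  have "word_length SL_Z S \<gamma> \<le> Max X * N" if "elem_word N \<gamma>" for N \<gamma>
    using that
  proof induction
    case one
    show ?case using word_length_one by (simp add: SL_group_simps)
  next
    case (mult N g i j k)
    have "word_length SL_Z S (transv i j k ** g) \<le> word_length SL_Z S (transv i j k) + word_length SL_Z S g"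
      using word_length_mult_le[OF S, of "transv i j k" g] mult.hyps det_elem_word
      by (auto simp: SL_group_simps det_transv)
    then show ?case using mult.IH K[OF mult.hyps(3), of i j] by simp
  qed simp
  then show thesis using that by blast
qed

lemma ex_entry_bound:
  assumes "finite A"
  obtains r where "\<And>M. M \<in> A \<Longrightarrow> entry_bound r M"
proof -
  define X where "X = (\<lambda>(M, a, b). nat \<bar>M $ a $ b\<bar>) ` (A \<times> UNIV \<times> UNIV)"
  have "finite X" using assms by (simp add: X_def)
  have "\<bar>M $ a $ b\<bar> \<le> 2 ^ Max X" if "M \<in> A" for M a b
  proof -
    have "nat \<bar>M $ a $ b\<bar> \<le> Max X"
      by (rule Max_ge[OF \<open>finite X\<close>]) (unfold X_def, rule image_eqI[of _ _ "(M, a, b)"], use that in auto)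
    also have "\<dots> \<le> 2 ^ Max X" by (simp add: less_imp_le)
    finally show ?thesis by (simp add: nat_le_iff)
  qed
  then have "entry_bound (Max X) M" if "M \<in> A" for M
    unfolding entry_bound_def using that by blast
  then show thesis using that by blast
qed

text \<open>The term \<open>CARD('n)\<close> accounts for the number of summands in an entry, by
  \<open>n \<le> 2 ^ n\<close>.\<close>

lemma entry_bound_mult:
  fixes A B :: "int^'n^'n"
  assumes "entry_bound r A" "entry_bound m B"
  shows "entry_bound (CARD('n) + r + m) (A ** B)"
  unfolding entry_bound_def
proof (intro allI)
  fix a b
  have "\<bar>(A ** B) $ a $ b\<bar> \<le> (\<Sum>c\<in>UNIV. \<bar>A $ a $ c * B $ c $ b\<bar>)"
    by (simp add: matrix_matrix_mult_def)
  also have "\<dots> \<le> (\<Sum>c\<in>(UNIV::'n set). 2 ^ r * 2 ^ m)"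
    by (intro sum_mono) (auto simp: abs_mult intro!: mult_mono entry_boundD assms)
  also have "\<dots> = int CARD('n) * 2 ^ (r + m)" by (simp add: power_add)
  also have "\<dots> \<le> 2 ^ CARD('n) * 2 ^ (r + m)"
    by (intro mult_right_mono) (auto simp: of_nat_less_two_power less_imp_le)
  finally show "\<bar>(A ** B) $ a $ b\<bar> \<le> 2 ^ (CARD('n) + r + m)"
    by (simp add: power_add)
qed

text \<open>Each generator adds a bounded number of bits. The estimate holds in every dimension and
  so serves the case \<open>n = 2\<close> of the first claim.\<close>

lemma entry_bound_word:
  fixes S :: "(int^'n^'n) set"
  assumes S: "finite S" "S \<subseteq> carrier SL_Z" "generate SL_Z S = carrier SL_Z"
  obtains R where "\<And>\<gamma>. \<gamma> \<in> carrier SL_Z \<Longrightarrow> entry_bound (R * word_length SL_Z S \<gamma>) \<gamma>"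
proof -
  interpret group "SL_Z :: (int^'n^'n) monoid" by (rule group_SL_Z)
  obtain r where r: "\<And>M. M \<in> S \<union> m_inv SL_Z ` S \<Longrightarrow> entry_bound r M"
    using ex_entry_bound[of "S \<union> m_inv SL_Z ` S"] S(1) by auto
  have word: "entry_bound ((CARD('n) + r) * length ws) (foldr (mult SL_Z) ws \<one>\<^bsub>SL_Z\<^esub>)"
    if "set ws \<subseteq> S \<union> m_inv SL_Z ` S" for ws
    using that
  proof (induction ws)
    case Nil
    show ?case by (simp add: SL_group_simps entry_bound_def mat_def)
  next
    case (Cons w ws)
    then show ?case
      using entry_bound_mult[OF r[of w] Cons.IH] by (simp add: SL_group_simps)
  qed
  have "entry_bound ((CARD('n) + r) * word_length SL_Z S \<gamma>) \<gamma>" if \<gamma>: "\<gamma> \<in> carrier SL_Z" for \<gamma>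
  proof -
    obtain ws where "length ws = word_length SL_Z S \<gamma>" "set ws \<subseteq> S \<union> m_inv SL_Z ` S"
        "foldr (mult SL_Z) ws \<one>\<^bsub>SL_Z\<^esub> = \<gamma>"
      using word_length_word[OF S(2,3) \<gamma>] .
    then show ?thesis using word by metis
  qed
  then show thesis using that by blast
qed

text \<open>Change of generators in the direction opposite to \<open>elem_word_word_length\<close>:
  the elements of \<open>S\<close> and their inverses have a common bit size, hence elementary words
  of bounded length.\<close>

lemma elem_word_of_word_length:
  fixes S :: "(int^'n^'n) set"
  assumes card: "CARD('n) \<ge> 3"
    and S: "finite S" "S \<subseteq> carrier SL_Z" "generate SL_Z S = carrier SL_Z"
  obtains K where "\<And>\<gamma>. \<gamma> \<in> carrier SL_Z \<Longrightarrow> elem_word (K * word_length SL_Z S \<gamma>) \<gamma>"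
proof -
  interpret group "SL_Z :: (int^'n^'n) monoid" by (rule group_SL_Z)
  obtain r where r: "\<And>M. M \<in> S \<union> m_inv SL_Z ` S \<Longrightarrow> entry_bound r M"
    using ex_entry_bound[of "S \<union> m_inv SL_Z ` S"] S(1) by auto
  obtain c where c: "\<And>m (M::int^'n^'n). \<lbrakk>det M = 1; entry_bound m M\<rbrakk> \<Longrightarrow> elem_word (c * (m + 1)) M"
    using elem_word_log_bound[OF card] by blast
  have sub: "S \<union> m_inv SL_Z ` S \<subseteq> carrier SL_Z" using S(2) by auto
  have word: "elem_word (c * (r + 1) * length ws) (foldr (mult SL_Z) ws \<one>\<^bsub>SL_Z\<^esub>)"
    if "set ws \<subseteq> S \<union> m_inv SL_Z ` S" for ws
    using that
  proof (induction ws)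
    case Nil
    show ?case by (simp add: SL_group_simps elem_word.one)
  next
    case (Cons w ws)
    have "elem_word (c * (r + 1)) w"
      using Cons.prems sub by (intro c r) (auto simp: SL_group_simps)
    moreover have "elem_word (c * (r + 1) * length ws) (foldr (mult SL_Z) ws \<one>\<^bsub>SL_Z\<^esub>)"
      using Cons by simp
    ultimately have "elem_word (c * (r + 1) + c * (r + 1) * length ws) (w ** foldr (mult SL_Z) ws \<one>\<^bsub>SL_Z\<^esub>)"
      by (rule elem_word_mult)
    then show ?case by (simp add: SL_group_simps)
  qed
  have "elem_word (c * (r + 1) * word_length SL_Z S \<gamma>) \<gamma>" if \<gamma>: "\<gamma> \<in> carrier SL_Z" for \<gamma>
  proof -
    obtain ws where "length ws = word_length SL_Z S \<gamma>" "set ws \<subseteq> S \<union> m_inv SL_Z ` S"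
        "foldr (mult SL_Z) ws \<one>\<^bsub>SL_Z\<^esub> = \<gamma>"
      using word_length_word[OF S(2,3) \<gamma>] .
    then show ?thesis using word by metis
  qed
  then show thesis using that by blast
qed

section \<open>Orbits and distances in the symmetric space\<close>

lemma mem_l_coset_SO:
  assumes "g \<in> carrier SL_R"
  shows "g \<in> g <#\<^bsub>SL_R\<^esub> SO_R"
proof -
  have "mat 1 \<in> SO_R"
    by (simp add: SO_R_def rotation_matrix_def orthogonal_matrix_def)
  then show ?thesis
    unfolding l_coset_def by (auto simp: SL_group_simps intro!: bexI[of _ "mat 1"])
qed

lemma mem_sym_spaceE:
  assumes "p \<in> sym_space"
  obtains g where "g \<in> carrier SL_R" "p = g <#\<^bsub>SL_R\<^esub> SO_R" "g \<in> p"
  using assms mem_l_coset_SO that by (auto simp: sym_space_def LCOSETS_def)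

lemma sym_space_act_mem: "g \<in> p \<Longrightarrow> map_matrix of_int \<gamma> ** g \<in> sym_space_act \<gamma> p"
  by (auto simp: sym_space_act_def l_coset_def SL_group_simps)

lemma sym_space_act_mult: "sym_space_act (\<gamma> ** \<delta>) p = sym_space_act \<gamma> (sym_space_act \<delta> p)"
  by (simp add: sym_space_act_def l_coset_def SL_group_simps map_matrix_of_int_mult matrix_mul_assoc)

lemma sym_space_dist_le: "L \<in> sym_space_curve_lengths p q \<Longrightarrow> sym_space_dist p q \<le> L"
  unfolding sym_space_dist_def
  by (rule cInf_lower) (auto intro!: bdd_belowI[of _ 0] sym_space_curve_lengths_nonneg)

text \<open>\<open>m\<close> is the binary logarithm of \<open>C * exp L\<close> rounded up; the
  assumptions make that logarithm nonnegative, so \<open>nat\<close> does not truncate.\<close>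

lemma entry_bound_ceiling_log:
  assumes "C \<ge> 1" "L \<ge> 0" "\<And>a b. real_of_int \<bar>\<gamma> $ a $ b\<bar> \<le> C * exp L"
  obtains m where "entry_bound m \<gamma>" "real m \<le> (ln C + L) / ln 2 + 1"
proof -
  define y where "y = (ln C + L) / ln 2"
  define m where "m = nat \<lceil>y\<rceil>"
  have "y \<ge> 0" using assms by (simp add: y_def)
  then have m: "real m \<le> y + 1" "y \<le> real m" unfolding m_def by linarith+
  have "C * exp L = exp (y * ln 2)"
    using assms(1) by (simp add: y_def exp_add)
  also have "\<dots> \<le> exp (real m * ln 2)"
    using m(2) by (simp add: mult_right_mono)
  also have "\<dots> = 2 ^ m"
    by (simp add: exp_of_nat_mult)
  finally have "real_of_int \<bar>\<gamma> $ a $ b\<bar> \<le> 2 ^ m" for a b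
    using assms(3) order_trans by blast
  then have "real_of_int \<bar>\<gamma> $ a $ b\<bar> \<le> real_of_int (2 ^ m)" for a b
    by simp
  then have "entry_bound m \<gamma>"
    unfolding entry_bound_def of_int_le_iff by blast
  then show thesis using that m(1) by (simp add: y_def)
qed

text \<open>Upper bound: an elementary word of comparable length gives a curve. Lower bound: a curve
  of length \<open>L\<close> bounds the entries by a multiple of \<open>exp L\<close>, hence the
  word length by a linear function of \<open>L\<close>.\<close>

lemma quasi_isometric_embedding_orbit_map:
  fixes S :: "(int^'n^'n) set"
  assumes card: "CARD('n) \<ge> 3"
    and S: "finite S" "S \<subseteq> carrier SL_Z" "generate SL_Z S = carrier SL_Z"
    and p: "p \<in> sym_space"
  shows "quasi_isometric_embedding (carrier SL_Z) (word_dist SL_Z S)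
           sym_space sym_space_dist (\<lambda>\<gamma>. sym_space_act \<gamma> p)"
proof -
  interpret group "SL_Z :: (int^'n^'n) monoid" by (rule group_SL_Z)
  let ?l = "word_length SL_Z S"
  obtain g where g: "g \<in> carrier SL_R" "p = g <#\<^bsub>SL_R\<^esub> SO_R" "g \<in> p"
    using mem_sym_spaceE[OF p] .
  obtain K1 where K1: "\<And>N \<gamma>. elem_word N \<gamma> \<Longrightarrow> ?l \<gamma> \<le> K1 * N"
    using elem_word_word_length[OF S(2,3)] by blast
  obtain K2 where K2: "\<And>\<gamma>. \<gamma> \<in> carrier SL_Z \<Longrightarrow> elem_word (K2 * ?l \<gamma>) \<gamma>"
    using elem_word_of_word_length[OF card S] by blast
  obtain K3 where K3: "K3 \<ge> 0" "\<And>N \<gamma>. elem_word N \<gamma> \<Longrightarrow>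
       \<exists>L\<in>sym_space_curve_lengths {g} {map_matrix of_int \<gamma> ** g}. L \<le> K3 * real N"
    using elem_word_curve_length[OF g(1)] by blast
  obtain c where c: "\<And>m (M::int^'n^'n). \<lbrakk>det M = 1; entry_bound m M\<rbrakk> \<Longrightarrow> elem_word (c * (m + 1)) M"
    using elem_word_log_bound[OF card] by blast
  obtain C where C: "C \<ge> 1" "\<And>\<gamma> L a b. L \<in> sym_space_curve_lengths p (sym_space_act \<gamma> p) \<Longrightarrow>
       real_of_int \<bar>\<gamma> $ a $ b\<bar> \<le> C * exp L"
    using curve_length_entry_bound[OF g(1)] g(2) by metis
  have path: "\<exists>L\<in>sym_space_curve_lengths p (sym_space_act \<gamma> p). L \<le> K3 * real K2 * real (?l \<gamma>)"
    if \<gamma>: "\<gamma> \<in> carrier SL_Z" for \<gamma>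
  proof -
    have "sym_space_curve_lengths {g} {map_matrix of_int \<gamma> ** g} \<subseteq> sym_space_curve_lengths p (sym_space_act \<gamma> p)"
      using g(3) sym_space_act_mem by (intro sym_space_curve_lengths_mono) auto
    then show ?thesis
      using K3(2)[OF K2[OF \<gamma>]] by (auto simp: mult.assoc)
  qed
  \<comment> \<open>Read off from \<open>K1 * (c * (m + 1))\<close> and the bound for
    \<open>m\<close>: division by \<open>ln 2\<close> converts lengths to bits, and the 2 is one for
    rounding and one for \<open>m + 1\<close>.\<close>
  define \<alpha> where "\<alpha> = real (K1 * c) / ln 2"
  define \<beta> where "\<beta> = real (K1 * c) * (ln C / ln 2 + 2)"
  have "\<alpha> \<ge> 0" "\<beta> \<ge> 0" using C(1) by (auto simp: \<alpha>_def \<beta>_def intro!: mult_nonneg_nonneg add_nonneg_nonneg)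
  have lower: "real (?l \<gamma>) \<le> \<alpha> * L + \<beta>"
    if \<gamma>: "\<gamma> \<in> carrier SL_Z" and L: "L \<in> sym_space_curve_lengths p (sym_space_act \<gamma> p)" for \<gamma> L
  proof -
    obtain m where m: "entry_bound m \<gamma>" "real m \<le> (ln C + L) / ln 2 + 1"
      using entry_bound_ceiling_log[OF C(1) sym_space_curve_lengths_nonneg[OF L] C(2)[OF L]] .
    have "?l \<gamma> \<le> K1 * (c * (m + 1))"
      using \<gamma> by (intro K1 c m) (simp add: SL_group_simps)
    then have "real (?l \<gamma>) \<le> real (K1 * (c * (m + 1)))"
      by (simp only: of_nat_le_iff)
    also have "\<dots> = real (K1 * c) * (real m + 1)"
      by (simp add: algebra_simps)
    also have "\<dots> \<le> real (K1 * c) * ((ln C + L) / ln 2 + 1 + 1)"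
      using m(2) by (intro mult_left_mono) auto
    also have "\<dots> = \<alpha> * L + \<beta>"
      by (simp add: \<alpha>_def \<beta>_def field_simps)
    finally show ?thesis .
  qed
  define A where "A = max 1 (max \<alpha> (K3 * real K2))"
  have A: "A \<ge> 1" "A \<ge> \<alpha>" "A \<ge> K3 * real K2" by (auto simp: A_def)
  have "inverse A * word_dist SL_Z S x y - \<beta> \<le> sym_space_dist (sym_space_act x p) (sym_space_act y p) \<and>
        sym_space_dist (sym_space_act x p) (sym_space_act y p) \<le> A * word_dist SL_Z S x y + \<beta>"
    if x: "x \<in> carrier SL_Z" and y: "y \<in> carrier SL_Z" for x y
  proof -
    \<comment> \<open>Both metrics are invariant under left translation by \<open>x\<close>, so it
      suffices to compare the word length of \<open>\<gamma>\<close> with the distance from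
      \<open>p\<close> to its image.\<close>
    define \<gamma> where "\<gamma> = inv\<^bsub>SL_Z\<^esub> x \<otimes>\<^bsub>SL_Z\<^esub> y"
    have \<gamma>: "\<gamma> \<in> carrier SL_Z" using x y by (simp add: \<gamma>_def)
    have "x \<otimes>\<^bsub>SL_Z\<^esub> \<gamma> = y" using x y by (simp add: \<gamma>_def m_assoc[symmetric])
    then have "sym_space_act y p = sym_space_act x (sym_space_act \<gamma> p)"
      using sym_space_act_mult[of x \<gamma> p] by (simp add: SL_group_simps)
    then have dist: "sym_space_dist (sym_space_act x p) (sym_space_act y p) = sym_space_dist p (sym_space_act \<gamma> p)"
      using sym_space_act_isometry[OF x p sym_space_act_closed[OF \<gamma> p]] by simp
    have word: "word_dist SL_Z S x y = real (?l \<gamma>)"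
      by (simp add: word_dist_def \<gamma>_def)
    obtain L where L: "L \<in> sym_space_curve_lengths p (sym_space_act \<gamma> p)" "L \<le> K3 * real K2 * real (?l \<gamma>)"
      using path[OF \<gamma>] by blast
    have "sym_space_dist p (sym_space_act \<gamma> p) \<le> A * real (?l \<gamma>)"
      using sym_space_dist_le[OF L(1)] L(2) mult_right_mono[OF A(3), of "real (?l \<gamma>)"] by simp
    moreover have "inverse A * real (?l \<gamma>) - \<beta> \<le> sym_space_dist p (sym_space_act \<gamma> p)"
      unfolding sym_space_dist_def
    proof (rule cInf_greatest)
      show "sym_space_curve_lengths p (sym_space_act \<gamma> p) \<noteq> {}" using L by blast
      fix M assume M: "M \<in> sym_space_curve_lengths p (sym_space_act \<gamma> p)"
      have "real (?l \<gamma>) \<le> \<alpha> * M + \<beta>" by (rule lower[OF \<gamma> M])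
      also have "\<dots> \<le> A * M + A * \<beta>"
        using A \<open>\<beta> \<ge> 0\<close> sym_space_curve_lengths_nonneg[OF M] mult_right_mono[of 1 A \<beta>]
        by (intro add_mono mult_right_mono) auto
      finally have "real (?l \<gamma>) \<le> A * (M + \<beta>)" by (simp add: distrib_left)
      then have "inverse A * real (?l \<gamma>) \<le> inverse A * (A * (M + \<beta>))"
        using A(1) by (intro mult_left_mono) auto
      moreover have "inverse A * (A * (M + \<beta>)) = M + \<beta>"
        using A(1) by (simp add: mult.assoc[symmetric])
      ultimately show "inverse A * real (?l \<gamma>) - \<beta> \<le> M"
        by linarith
    qed
    ultimately show ?thesis using \<open>\<beta> \<ge> 0\<close> by (simp add: dist word)
  qed
  moreover have "(\<lambda>\<gamma>. sym_space_act \<gamma> p) \<in> carrier SL_Z \<rightarrow> sym_space"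
    using sym_space_act_closed p by auto
  ultimately show ?thesis
    unfolding quasi_isometric_embedding_def using A(1) \<open>\<beta> \<ge> 0\<close> by blast
qed

subsection \<open>Unipotent elements\<close>

text \<open>Conjugation by the diagonal matrix \<open>g\<close> divides the off-diagonal entry by
  \<open>k ^ 2\<close>, so the curve of \<open>transv_curve_length\<close> starting at
  \<open>g\<close> has length at most \<open>1 / k\<close>. Only a bound independent of
  \<open>k\<close> matters.\<close>

lemma displacement_transv_le:
  fixes i j :: "'n::finite"
  assumes ij: "i \<noteq> j" and k: "k \<ge> 1"
  shows "displacement sym_space sym_space_dist (sym_space_act (transv i j (int k))) \<le> 1"
proof -
  let ?\<gamma> = "transv i j (int k) :: int^'n^'n"
  let ?T = "transv i j (real k) :: real^'n^'n"
  have T: "map_matrix of_int ?\<gamma> = ?T"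
    by (simp add: map_matrix_of_int_transv)
  have lengths: "\<exists>L\<in>sym_space_curve_lengths p (sym_space_act ?\<gamma> p).
      L \<le> norm (matrix_inv g ** ((?T - mat 1) ** g))"
    if "g \<in> carrier SL_R" "g \<in> p" for g p
  proof -
    have "sym_space_curve_lengths {g} {?T ** g} \<subseteq> sym_space_curve_lengths p (sym_space_act ?\<gamma> p)"
      using that sym_space_act_mem[of g p ?\<gamma>] by (intro sym_space_curve_lengths_mono) (auto simp: T)
    then show ?thesis using transv_curve_length[OF that(1) ij] by blast
  qed
  \<comment> \<open>The infimum over \<open>p\<close> is a lower bound only if the distances are
    bounded below. Each distance is itself an infimum of nonnegative lengths and says nothing
    without some connecting curve.\<close>
  have nonneg: "0 \<le> sym_space_dist p (sym_space_act ?\<gamma> p)" if p: "p \<in> sym_space" for p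
  proof -
    obtain g where "g \<in> carrier SL_R" "g \<in> p" using mem_sym_spaceE[OF p] by metis
    then have "sym_space_curve_lengths p (sym_space_act ?\<gamma> p) \<noteq> {}" using lengths by blast
    then show ?thesis
      unfolding sym_space_dist_def by (rule cInf_greatest) (rule sym_space_curve_lengths_nonneg)
  qed
  define d where "d s = (\<chi> a b. if a = b then (if a = i then s else if a = j then inverse s else 1) else 0 :: real^'n^'n)"
    for s :: real
  have det_d: "det (d s) = 1" if "s \<noteq> 0" for s
  proof -
    have "det (d s) = (\<Prod>a\<in>UNIV. (if a = i then s else 1) * (if a = j then inverse s else 1))"
      by (subst det_diagonal) (use ij in \<open>auto simp: d_def intro!: prod.cong\<close>)
    then show ?thesis using that by (simp add: prod.distrib)
  qed
  have kpos: "real k \<noteq> 0" using k by simp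
  define g where "g = d (real k)"
  have g: "g \<in> carrier SL_R" using det_d[OF kpos] by (simp add: g_def SL_group_simps)
  have dd: "d s ** M = (\<chi> a b. (if a = i then s else if a = j then inverse s else 1) * M $ a $ b)" for s and M :: "real^'n^'n"
  proof -
    have "(d s ** M) $ a $ b = (\<Sum>c\<in>UNIV. if c = a then
        (if a = i then s else if a = j then inverse s else 1) * M $ a $ b else 0)" for a b
      unfolding matrix_matrix_mult_def vec_lambda_beta by (rule sum.cong) (auto simp: d_def)
    then show ?thesis by (simp add: vec_eq_iff)
  qed
  have "d (inverse (real k)) ** g = mat 1"
    using kpos ij by (auto simp: dd g_def vec_eq_iff) (auto simp: d_def mat_def)
  then have inv: "matrix_inv g = d (inverse (real k))"
    using matrix_inverse_unique matrix_inv_SL(3)[OF g] by metis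
  have "(?T - mat 1) ** g = axis i (axis j 1)"
  proof -
    have "((?T - mat 1) ** g) $ a $ b = (axis i (axis j 1) :: real^'n^'n) $ a $ b" for a b
    proof -
      have "((?T - mat 1) ** g) $ a $ b = (\<Sum>c\<in>UNIV. if c = j then (if a = i then real k else 0) * g $ c $ b else 0)"
        unfolding matrix_matrix_mult_def vec_lambda_beta
        by (rule sum.cong) (auto simp: transv_def mat_def)
      then show ?thesis
        using kpos ij by (auto simp: g_def d_def axis_def)
    qed
    then show ?thesis by (simp add: vec_eq_iff)
  qed
  then have "matrix_inv g ** ((?T - mat 1) ** g) = axis i (axis j (inverse (real k)))"
    by (auto simp: inv dd vec_eq_iff axis_def)
  moreover have "norm (axis i (axis j (inverse (real k))) :: real^'n^'n) = inverse (real k)"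
    by (simp add: norm_eq_sqrt_inner inner_axis')
  ultimately have norm: "norm (matrix_inv g ** ((?T - mat 1) ** g)) \<le> 1"
    using k by (simp add: inverse_le_1_iff)
  define p where "p = g <#\<^bsub>SL_R\<^esub> SO_R"
  have p: "p \<in> sym_space"
    using g by (auto simp: p_def sym_space_def LCOSETS_def)
  have "g \<in> p"
    unfolding p_def by (rule mem_l_coset_SO[OF g])
  then obtain L where "L \<in> sym_space_curve_lengths p (sym_space_act ?\<gamma> p)" "L \<le> 1"
    using lengths[OF g] norm by (meson order_trans)
  then have "sym_space_dist p (sym_space_act ?\<gamma> p) \<le> 1"
    using sym_space_dist_le order_trans by blast
  moreover have "displacement sym_space sym_space_dist (sym_space_act ?\<gamma>) \<le> sym_space_dist p (sym_space_act ?\<gamma> p)"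
    unfolding displacement_def
    by (rule cINF_lower) (use p nonneg in \<open>auto intro!: bdd_belowI[of _ 0]\<close>)
  ultimately show ?thesis by simp
qed

text \<open>The conjugate differs from the identity by \<open>k\<close> times the product of column
  \<open>i\<close> of \<open>\<eta>\<close> and row \<open>j\<close> of \<open>h\<close>. Both are
  nonzero by invertibility, and a nonzero integer has absolute value at least 1; the identity costs
  the \<open>- 1\<close>.\<close>

lemma conjugate_transv_entry:
  fixes \<eta> :: "int^'n^'n"
  assumes ij: "i \<noteq> j" and h: "h ** \<eta> = mat 1" "\<eta> ** h = mat 1" and k: "k \<ge> 0"
  obtains a b where "\<bar>(\<eta> ** transv i j k ** h) $ a $ b\<bar> \<ge> k - 1"
proof -
  have entry: "(\<eta> ** transv i j k ** h) $ a $ b = (if a = b then 1 else 0) + k * (\<eta> $ a $ i * h $ j $ b)" for a b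
  proof -
    have "(\<eta> ** (transv i j k ** h)) $ a $ b =
        (\<Sum>c\<in>UNIV. \<eta> $ a $ c * h $ c $ b + (if c = i then k * (\<eta> $ a $ i * h $ j $ b) else 0))"
      unfolding matrix_matrix_mult_def[of \<eta>] vec_lambda_beta
      by (rule sum.cong) (auto simp: transv_mult_nth algebra_simps)
    also have "\<dots> = (\<eta> ** h) $ a $ b + k * (\<eta> $ a $ i * h $ j $ b)"
      by (simp add: sum.distrib matrix_matrix_mult_def)
    finally show ?thesis by (simp add: h mat_def matrix_mul_assoc)
  qed
  have "\<exists>a. h $ l $ a * \<eta> $ a $ l \<noteq> 0" for l
  proof (rule ccontr)
    assume "\<nexists>a. h $ l $ a * \<eta> $ a $ l \<noteq> 0"
    then have "(h ** \<eta>) $ l $ l = 0"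
      unfolding matrix_matrix_mult_def vec_lambda_beta by (intro sum.neutral) blast
    then show False by (simp add: h mat_def)
  qed
  from this[of i] this[of j] obtain a b where "h $ i $ a * \<eta> $ a $ i \<noteq> 0" "h $ j $ b * \<eta> $ b $ j \<noteq> 0"
    by blast
  then have "\<eta> $ a $ i \<noteq> 0" "h $ j $ b \<noteq> 0" by auto
  then have "1 \<le> \<bar>\<eta> $ a $ i * h $ j $ b\<bar>"
    using mult_eq_0_iff[of "\<eta> $ a $ i" "h $ j $ b"] by linarith
  then have "k * 1 \<le> \<bar>k * (\<eta> $ a $ i * h $ j $ b)\<bar>"
    unfolding abs_mult[of k] using k by (intro mult_mono) auto
  then have "\<bar>(\<eta> ** transv i j k ** h) $ a $ b\<bar> \<ge> k - 1"
    unfolding entry by auto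
  then show thesis by (rule that)
qed

lemma translation_length_transv:
  fixes S :: "(int^'n^'n) set"
  assumes S: "finite S" "S \<subseteq> carrier SL_Z" "generate SL_Z S = carrier SL_Z"
  obtains R where "\<And>i j k. i \<noteq> j \<Longrightarrow> int k - 1 \<le> 2 ^ (R * translation_length SL_Z S (transv i j (int k)))"
proof -
  interpret group "SL_Z :: (int^'n^'n) monoid" by (rule group_SL_Z)
  obtain R where R: "\<And>\<gamma>. \<gamma> \<in> carrier SL_Z \<Longrightarrow> entry_bound (R * word_length SL_Z S \<gamma>) \<gamma>"
    using entry_bound_word[OF S] by blast
  have "int k - 1 \<le> 2 ^ (R * translation_length SL_Z S (transv i j (int k)))" if ij: "i \<noteq> j" for i j k
  proof -
    let ?\<gamma> = "transv i j (int k) :: int^'n^'n"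
    \<comment> \<open>An infimum of natural numbers is attained, so a single conjugate realises the
      translation length.\<close>
    have "translation_length SL_Z S ?\<gamma> \<in>
        (\<lambda>\<eta>. word_length SL_Z S (\<eta> \<otimes>\<^bsub>SL_Z\<^esub> ?\<gamma> \<otimes>\<^bsub>SL_Z\<^esub> inv\<^bsub>SL_Z\<^esub> \<eta>)) ` carrier SL_Z"
      unfolding translation_length_def by (rule Inf_nat_def1) auto
    then obtain \<eta> where \<eta>: "\<eta> \<in> carrier SL_Z" and
      len: "translation_length SL_Z S ?\<gamma> = word_length SL_Z S (\<eta> \<otimes>\<^bsub>SL_Z\<^esub> ?\<gamma> \<otimes>\<^bsub>SL_Z\<^esub> inv\<^bsub>SL_Z\<^esub> \<eta>)"
      by auto
    define h where "h = inv\<^bsub>SL_Z\<^esub> \<eta>"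
    have h: "h ** \<eta> = mat 1" "\<eta> ** h = mat 1"
      using l_inv[OF \<eta>] r_inv[OF \<eta>] by (simp_all add: SL_group_simps h_def)
    have "\<eta> \<otimes>\<^bsub>SL_Z\<^esub> ?\<gamma> \<otimes>\<^bsub>SL_Z\<^esub> h \<in> carrier SL_Z"
      unfolding h_def by (intro m_closed inv_closed \<eta> transv_in_SL ij)
    from R[OF this] have bound: "entry_bound (R * translation_length SL_Z S ?\<gamma>) (\<eta> ** ?\<gamma> ** h)"
      by (simp add: len h_def SL_group_simps)
    obtain a b where "\<bar>(\<eta> ** ?\<gamma> ** h) $ a $ b\<bar> \<ge> int k - 1"
      using conjugate_transv_entry[OF ij h, of "int k"] by auto
    then show ?thesis using entry_boundD[OF bound, of a b] by linarith
  qed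
  then show thesis using that by blast
qed

lemma not_well_displacing_SL_Z:
  fixes S :: "(int^'n^'n) set"
  assumes card: "CARD('n) \<ge> 2"
    and S: "finite S" "S \<subseteq> carrier SL_Z" "generate SL_Z S = carrier SL_Z"
  shows "\<not> well_displacing SL_Z S sym_space sym_space_dist sym_space_act"
proof
  assume "well_displacing SL_Z S sym_space sym_space_dist sym_space_act"
  then obtain A B where AB: "A > 0" "B > 0" "\<And>\<gamma>. \<gamma> \<in> carrier SL_Z \<Longrightarrow>
      A * real (translation_length SL_Z S \<gamma>) - B \<le> displacement sym_space sym_space_dist (sym_space_act \<gamma>)"
    unfolding well_displacing_def by blast
  obtain R where R: "\<And>i j k. i \<noteq> j \<Longrightarrow> int k - 1 \<le> 2 ^ (R * translation_length SL_Z S (transv i j (int k)))"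
    using translation_length_transv[OF S] by blast
  obtain i j :: 'n where ij: "i \<noteq> j"
    using card card_le_Suc0_iff_eq[of "UNIV :: 'n set"] by fastforce
  \<comment> \<open>If the action were well displacing, displacement at most 1 would force
    translation length at most \<open>t\<close>; \<open>k\<close> is chosen with
    \<open>k - 1 > 2 ^ (R * t)\<close> to contradict this.\<close>
  define t where "t = nat \<lceil>(1 + B) / A\<rceil>"
  define k where "k = (2::nat) ^ (R * t) + 2"
  let ?\<gamma> = "transv i j (int k) :: int^'n^'n"
  have "A * real (translation_length SL_Z S ?\<gamma>) - B \<le> 1"
    using AB(3)[OF transv_in_SL[OF ij, of "int k"]] displacement_transv_le[OF ij, of k] by (simp add: k_def)
  then have "real (translation_length SL_Z S ?\<gamma>) \<le> (1 + B) / A"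
    using AB(1) by (simp add: field_simps)
  then have "translation_length SL_Z S ?\<gamma> \<le> t"
    unfolding t_def by linarith
  then have "(2::int) ^ (R * translation_length SL_Z S ?\<gamma>) \<le> 2 ^ (R * t)"
    by (intro power_increasing) auto
  then have "int k - 1 \<le> 2 ^ (R * t)"
    using R[OF ij, of k] by linarith
  then show False by (simp add: k_def)
qed

theorem proposition5p0p7:
  fixes S :: "(int^'n^'n) set"
  assumes "CARD('n) \<ge> 2"
    and "finite S" and "S \<subseteq> carrier SL_Z" and "generate SL_Z S = carrier SL_Z"
  shows "\<not> well_displacing SL_Z S sym_space sym_space_dist sym_space_act \<and>
         (CARD('n) \<ge> 3 \<longrightarrow>
           (\<forall>p\<in>sym_space.
              quasi_isometric_embedding (carrier SL_Z) (word_dist SL_Z S)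
                sym_space sym_space_dist (\<lambda>\<gamma>. sym_space_act \<gamma> p)))"
  using not_well_displacing_SL_Z[OF assms] quasi_isometric_embedding_orbit_map[OF _ assms(2-4)] by blast

end
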